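(* For any time $t$ and any adversarial pattern $\mathcal{A}$, the pending cost of algorithm $\gamma$n-Burst satisfies $$\mathcal{C}_t(\gamma\text{n-Burst},\mathcal{A}) \leq \mathcal{C}_t(\mathrm{OPT},\mathcal{A}) + \ell_{max}(n^2 + 2n) + \ell_{min}\left(n^2 + \left(1+\left\lceil \frac{\ell_{max}}{s \cdot \ell_{min}} \right\rceil\right)n\right).$$
   Context: A system of $n$ crash-prone processors (an omniscient adversary may crash and restart them at arbitrary times, and a restarted processor remembers nothing but the algorithm and $n$) obtains pending tasks from a shared repository. Each processor repeatedly performs a cycle: get the set of pending tasks, execute one task (taking time equal to its cost divided by the speedup $s\ge 1$; tasks are non-preemptive and atomic), then inform the repository, which removes it. The adversary also injects tasks over time. Here tasks have only two possible costs, $\ell_{min} < \ell_{max}$. Let $\gamma = \max\{\lceil \frac{\ell_{max}-s\ell_{min}}{(s-1)\ell_{min}}\rceil, 0\}$, i.e., the smallest non-negative integer with $\frac{\gamma\ell_{min}+\ell_{max}}{s}\le(\gamma+1)\ell_{min}$. The speedup satisfies $\frac{\gamma \ell_{min}+\ell_{max}}{\ell_{max}} \leq s < \frac{\ell_{max}}{\ell_{min}}$. Algorithm $\gamma$n-Burst (run at processor $p$, with speedup $s$): each cycle it resets a counter $c\gets 0$ on (re)start, gets the pending tasks, splits them into lists $L_{min}$ and $L_{max}$ of $\ell_{min}$- and $\ell_{max}$-tasks sorted by arrival time, and then: (Case 1) if $|L_{min}|<n^2$ and $|L_{max}|<n^2$: if the previously performed task had cost $\ell_{min}$, perform task $(p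 n) \bmod |L_{max}|$ of $L_{max}$ and set $c\gets0$, else perform task $(pn)\bmod|L_{min}|$ of $L_{min}$ and set $c\gets\min(c+1,\gamma)$; (Case 2) if $|L_{min}|\ge n^2$, $|L_{max}|<n^2$: perform the task at position $pn$ in $L_{min}$, $c\gets\min(c+1,\gamma)$; (Case 3) if $|L_{min}|<n^2$, $|L_{max}|\ge n^2$: perform the task at position $pn$ in $L_{max}$, $c\gets 0$; (Case 4) if both have at least $n^2$ tasks: if $c=\gamma$ perform the task at position $pn$ in $L_{max}$ and set $c\gets0$, else perform the task at position $pn$ in $L_{min}$ and set $c\gets\min(c+1,\gamma)$; finally inform the repository. $\mathcal{C}_t(\mathrm{ALG},\mathcal{A})$ denotes the pending cost (sum of costs of injected but not yet reported completed tasks) at time $t$ for algorithm ALG under adversarial pattern $\mathcal{A}$ (crash, restart and injection events), and $\mathcal{C}_t(\mathrm{OPT},\mathcal{A})$ is the minimum (infimum) such value achievable by any offline algorithm that knows $\mathcal{A}$ in advance and runs without speedup. *)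

theory Defs
  imports Complex_Main "HOL-Library.Extended_Real"
begin

text \<open>
  Model of the shared-repository system.
  Tasks are identified by natural numbers.  An adversarial pattern fixes
  the set of injected tasks, their arrival times and costs, and for every
  processor p its set of runs: a run (b, e) means that p is (re)started at
  time b and stays alive on the half-open interval [b, e) (e = \<infinity> if it
  never crashes again); it crashes at time e.
\<close>

record adv_pattern =
  inj  :: "nat set"
  arr  :: "nat \<Rightarrow> real"
  cost :: "nat \<Rightarrow> real"
  runs :: "nat \<Rightarrow> (real \<times> ereal) set"

definition wf_pattern :: "nat \<Rightarrow> real \<Rightarrow> real \<Rightarrow> adv_pattern \<Rightarrow> bool" where
  "wf_pattern n lmin lmax A \<longleftrightarrow>
     (\<forall>\<tau>\<in>inj A. cost A \<tau> = lmin \<or> cost A \<tau> = lmax) \<and>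
     (\<forall>t. finite {\<tau>\<in>inj A. arr A \<tau> \<le> t}) \<and>
     (\<forall>p. \<forall>(b, e)\<in>runs A p. ereal b < e) \<and>
     (\<forall>p. \<forall>(b, e)\<in>runs A p. \<forall>(b', e')\<in>runs A p.
          (b, e) \<noteq> (b', e') \<longrightarrow> e \<le> ereal b' \<or> e' \<le> ereal b)"

definition gamma :: "real \<Rightarrow> real \<Rightarrow> real \<Rightarrow> nat" where
  "gamma s lmin lmax = nat (max \<lceil>(lmax - s * lmin) / ((s - 1) * lmin)\<rceil> 0)"

definition pending :: "adv_pattern \<Rightarrow> (nat \<times> real) set \<Rightarrow> real \<Rightarrow> nat set" where
  "pending A Rep t = {\<tau>\<in>inj A. arr A \<tau> \<le> t \<and> \<not> (\<exists>f\<le>t. (\<tau>, f) \<in> Rep)}"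

definition pending_cost :: "adv_pattern \<Rightarrow> (nat \<times> real) set \<Rightarrow> real \<Rightarrow> real" where
  "pending_cost A Rep t = (\<Sum>\<tau>\<in>pending A Rep t. cost A \<tau>)"

text \<open>Counter c after the history hist (tasks performed so far in the current run,
  chronological order), starting from c = 0 at (re)start.\<close>
definition burst_counter :: "nat \<Rightarrow> real \<Rightarrow> (nat \<Rightarrow> real) \<Rightarrow> nat list \<Rightarrow> nat" where
  "burst_counter \<gamma> lmin c hist =
     fold (\<lambda>\<tau> k. if c \<tau> = lmin then min (k + 1) \<gamma> else 0) hist 0"

text \<open>Task chosen by processor p, given the pending set pend and the history.
  Lists are sorted by arrival time (stable sort, ties by task id).  Positions
  "(p n) mod |L|" are 0-based list indices; "position p n" (cases 2-4) is the
  (p n)-th element, i.e. 0-based index p n - 1.  In Case 1, if the preferred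
  list is empty, the task is taken from the other list.\<close>
definition burst_choice ::
  "nat \<Rightarrow> nat \<Rightarrow> real \<Rightarrow> real \<Rightarrow> adv_pattern \<Rightarrow> nat \<Rightarrow> nat list \<Rightarrow> nat set \<Rightarrow> nat" where
  "burst_choice n \<gamma> lmin lmax A p hist pend =
    (let Lmin = sort_key (arr A) (sorted_list_of_set {\<tau>\<in>pend. cost A \<tau> = lmin});
         Lmax = sort_key (arr A) (sorted_list_of_set {\<tau>\<in>pend. cost A \<tau> = lmax});
         c = burst_counter \<gamma> lmin (cost A) hist;
         prev_min = (hist \<noteq> [] \<and> cost A (last hist) = lmin)
     in if length Lmin < n^2 \<and> length Lmax < n^2 then
          (if prev_min then
             (if Lmax \<noteq> [] then Lmax ! (p * n mod length Lmax) else Lmin ! (p * n mod length Lmin))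
           else
             (if Lmin \<noteq> [] then Lmin ! (p * n mod length Lmin) else Lmax ! (p * n mod length Lmax)))
        else if n^2 \<le> length Lmin \<and> length Lmax < n^2 then Lmin ! (p * n - 1)
        else if length Lmin < n^2 \<and> n^2 \<le> length Lmax then Lmax ! (p * n - 1)
        else if c = \<gamma> then Lmax ! (p * n - 1) else Lmin ! (p * n - 1))"

text \<open>An execution X assigns to processor p, run R and cycle index k either
  None (no k-th cycle in that run) or Some (\<sigma>, \<tau>): at time \<sigma> the processor
  gets the pending set and starts executing \<tau>, which takes cost/s time.
  The task is reported at \<sigma> + cost/s if the processor is still alive then.\<close>
type_synonym execution = "nat \<Rightarrow> real \<times> ereal \<Rightarrow> nat \<Rightarrow> (real \<times> nat) option"

definition reports :: "nat \<Rightarrow> real \<Rightarrow> adv_pattern \<Rightarrow> execution \<Rightarrow> (nat \<times> real) set" where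
  "reports n s A X = {(\<tau>, f). \<exists>p\<in>{1..n}. \<exists>b e k \<sigma>. (b, e) \<in> runs A p \<and>
       X p (b, e) k = Some (\<sigma>, \<tau>) \<and> f = \<sigma> + cost A \<tau> / s \<and> ereal f < e}"

definition history :: "execution \<Rightarrow> nat \<Rightarrow> real \<times> ereal \<Rightarrow> nat \<Rightarrow> nat list" where
  "history X p R k = map (\<lambda>i. snd (the (X p R i))) [0..<k]"

definition ready_time :: "real \<Rightarrow> adv_pattern \<Rightarrow> execution \<Rightarrow> nat \<Rightarrow> real \<times> ereal \<Rightarrow> nat \<Rightarrow> real option" where
  "ready_time s A X p R k =
     (if k = 0 then Some (fst R)
      else (case X p R (k - 1) of
              None \<Rightarrow> None
            | Some (\<sigma>, \<tau>) \<Rightarrow> (if ereal (\<sigma> + cost A \<tau> / s) < snd R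
                               then Some (\<sigma> + cost A \<tau> / s) else None)))"

definition burst_exec :: "nat \<Rightarrow> real \<Rightarrow> real \<Rightarrow> real \<Rightarrow> adv_pattern \<Rightarrow> execution \<Rightarrow> bool" where
  "burst_exec n s lmin lmax A X \<longleftrightarrow>
    (\<forall>p\<in>{1..n}. \<forall>b e. (b, e) \<in> runs A p \<longrightarrow> (\<forall>k.
       let pend = pending A (reports n s A X) in
       (case ready_time s A X p (b, e) k of
          None \<Rightarrow> X p (b, e) k = None
        | Some r \<Rightarrow>
            (if \<exists>t. r \<le> t \<and> ereal t < e \<and> pend t \<noteq> {} then
               (\<exists>\<sigma>. r \<le> \<sigma> \<and> ereal \<sigma> < e \<and> pend \<sigma> \<noteq> {} \<and>
                    (\<forall>t. r \<le> t \<and> t < \<sigma> \<longrightarrow> pend t = {}) \<and>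
                    X p (b, e) k = Some (\<sigma>, burst_choice n (gamma s lmin lmax) lmin lmax A p
                                             (history X p (b, e) k) (pend \<sigma>)))
             else X p (b, e) k = None))))"

definition valid_offline :: "nat \<Rightarrow> adv_pattern \<Rightarrow> (nat \<times> real \<times> nat) set \<Rightarrow> bool" where
  "valid_offline n A S \<longleftrightarrow>
     (\<forall>(p, \<sigma>, \<tau>)\<in>S. p \<in> {1..n} \<and> \<tau> \<in> inj A \<and> arr A \<tau> \<le> \<sigma> \<and>
         (\<exists>(b, e)\<in>runs A p. b \<le> \<sigma> \<and> ereal (\<sigma> + cost A \<tau>) < e)) \<and>
     (\<forall>(p, \<sigma>, \<tau>)\<in>S. \<forall>(p', \<sigma>', \<tau>')\<in>S. p = p' \<and> (\<sigma>, \<tau>) \<noteq> (\<sigma>', \<tau>') \<longrightarrow>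
         \<sigma> + cost A \<tau> \<le> \<sigma>' \<or> \<sigma>' + cost A \<tau>' \<le> \<sigma>)"

definition offline_reports :: "adv_pattern \<Rightarrow> (nat \<times> real \<times> nat) set \<Rightarrow> (nat \<times> real) set" where
  "offline_reports A S = {(\<tau>, \<sigma> + cost A \<tau>) | p \<sigma> \<tau>. (p, \<sigma>, \<tau>) \<in> S}"

definition opt_pending_cost :: "nat \<Rightarrow> adv_pattern \<Rightarrow> real \<Rightarrow> real" where
  "opt_pending_cost n A t =
     (INF S\<in>{S. valid_offline n A S}. pending_cost A (offline_reports A S) t)"

end

theory Submission
  imports Defs
begin

text \<open>
  Fix an offline schedule.  Whenever a queue holds at least n^2 tasks, processors working on
  it never duplicate work, so completions in the runs of each processor can be counted separately.
  Since (gamma lmin + lmax) / s \<le> lmax, every run started while the lmax-queue is long completes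
  at least as many lmax-tasks as the offline schedule; counting from the last time at which that
  queue was short, and allowing for one run per processor already under way at that time,
  the number of pending lmax-tasks exceeds the offline one by at most n^2 + 2 n.  Since
  (gamma lmin + lmax) / s \<le> (gamma + 1) lmin, every run started while the lmin-queue is long
  completes at least as many tasks, of both costs together, as the offline schedule.
  Total cost is not monotone run by run: an lmax-task may turn up in the middle of a run
  and be lost in a crash.  The bound for it is obtained instead as lmin times the bound on the
  number of tasks plus lmax - lmin times the bound on the number of lmax-tasks.
\<close>

section \<open>Positions in sorted lists and packing of separated points\<close>

text \<open>Stable sorting of an increasing list by the key \<open>f\<close> produces precisely this
  order. It does not refer to a list, so the position of a task becomes the number of pending tasks
  that precede it.\<close>

definition earlier :: "(nat \<Rightarrow> real) \<Rightarrow> nat \<Rightarrow> nat \<Rightarrow> bool" where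
  "earlier f x y \<longleftrightarrow> f x < f y \<or> f x = f y \<and> x < y"

text \<open>\<open>insort_key\<close> places \<open>x\<close> in front of all entries with an equal
  key, which agrees with the tie-break because \<open>x\<close> is the smallest number.\<close>

lemma sorted_wrt_earlier_insort_key:
  assumes "sorted_wrt (earlier f) ys" and "\<forall>y\<in>set ys. x < y"
  shows "sorted_wrt (earlier f) (insort_key f x ys)"
  using assms by (induction ys) (fastforce simp: earlier_def set_insort_key)+

lemma sorted_wrt_earlier_sort_key:
  assumes "sorted_wrt (<) xs"
  shows "sorted_wrt (earlier f) (sort_key f xs)"
  using assms by (induction xs) (auto intro: sorted_wrt_earlier_insort_key)

text \<open>The predecessors of entry \<open>i\<close> are exactly the first \<open>i\<close>
  entries. Changes of position can thus be followed by comparing sets of predecessors at two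
  times.\<close>

lemma card_earlier_nth:
  assumes "sorted_wrt (earlier f) L" and "i < length L"
  shows "card {x \<in> set L. earlier f x (L ! i)} = i"
proof -
  have ord: "earlier f (L ! j) (L ! k)" if "j < k" "k < length L" for j k
    using assms(1) that by (simp add: sorted_wrt_iff_nth_less)
  have irr: "\<not> earlier f (L ! j) (L ! i)" if "i \<le> j" "j < length L" for j
    using ord[of i j] that by (cases "i = j") (auto simp: earlier_def)
  have "distinct L"
    unfolding distinct_conv_nth
    by (metis earlier_def less_irrefl linorder_neqE_nat ord)
  have "{x \<in> set L. earlier f x (L ! i)} = set (take i L)"
  proof (intro equalityI subsetI)
    fix x assume "x \<in> {x \<in> set L. earlier f x (L ! i)}"
    then obtain j where j: "j < length L" "x = L ! j" "earlier f x (L ! i)"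
      by (auto simp: in_set_conv_nth)
    with irr[of j] have "j < i" by (meson not_less)
    with j assms(2) show "x \<in> set (take i L)" by (auto simp: in_set_conv_nth)
  next
    fix x assume "x \<in> set (take i L)"
    then obtain j where "j < i" "x = L ! j" using assms(2) by (auto simp: in_set_conv_nth)
    then show "x \<in> {x \<in> set L. earlier f x (L ! i)}"
      using assms(2) ord[of j i] by simp
  qed
  then show ?thesis
    using \<open>distinct L\<close> assms(2) by (simp add: distinct_card)
qed

text \<open>Removing the largest point leaves points in an interval shorter by \<open>l\<close>. The
  points will be completion times of non-overlapping offline executions.\<close>

lemma card_separated_le:
  fixes f :: "'a \<Rightarrow> real"
  assumes "finite F" "F \<noteq> {}" "0 \<le> l"
    and "\<And>x. x \<in> F \<Longrightarrow> a \<le> f x \<and> f x \<le> c"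
    and "\<And>x y. x \<in> F \<Longrightarrow> y \<in> F \<Longrightarrow> x \<noteq> y \<Longrightarrow> l \<le> \<bar>f x - f y\<bar>"
  shows "(real (card F) - 1) * l \<le> c - a"
  using assms
proof (induction "card F" arbitrary: F c)
  case 0
  then show ?case by simp
next
  case (Suc m)
  obtain x where x: "x \<in> F" "\<And>y. y \<in> F \<Longrightarrow> f y \<le> f x"
    using Max_in[of "f ` F"] Max_ge[of "f ` F"] Suc.prems(1,2)
    by (metis (no_types, lifting) finite_imageI image_iff image_is_empty)
  show ?case
  proof (cases "F = {x}")
    case True
    then show ?thesis using Suc.prems(4)[OF x(1)] by simp
  next
    case False
    let ?F = "F - {x}"
    have "card ?F = m" using Suc.hyps(2) x(1) Suc.prems(1) by simp
    moreover have "?F \<noteq> {}" using False x(1) by blast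
    moreover have "a \<le> f y \<and> f y \<le> f x - l" if "y \<in> ?F" for y
      using that Suc.prems(4)[of y] Suc.prems(5)[of x y] x(1) x(2)[of y] by auto
    ultimately have "(real (card ?F) - 1) * l \<le> (f x - l) - a"
      using Suc.prems by (intro Suc.hyps(1)) auto
    moreover have "real (card F) = real (card ?F) + 1"
      using \<open>card ?F = m\<close> Suc.hyps(2) by simp
    ultimately show ?thesis
      using Suc.prems(4)[OF x(1)] by (simp add: algebra_simps)
  qed
qed

section \<open>Executions of the algorithm as sequences of cycles\<close>

locale burst =
  fixes n :: nat and s lmin lmax :: real and A :: adv_pattern and X :: execution
  assumes n_pos: "1 \<le> n"
    and lmin_pos: "0 < lmin" and lmin_lmax: "lmin < lmax"
    and s_gt1: "1 < s"
    and s_ge: "(real (gamma s lmin lmax) * lmin + lmax) / lmax \<le> s"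
    and s_less: "s < lmax / lmin"
    and wf: "wf_pattern n lmin lmax A"
    and exec: "burst_exec n s lmin lmax A X"
begin

abbreviation "g \<equiv> gamma s lmin lmax"
abbreviation "Rep \<equiv> reports n s A X"
abbreviation "pend \<equiv> pending A Rep"
abbreviation "fin \<sigma> \<tau> \<equiv> \<sigma> + cost A \<tau> / s"
abbreviation "cnt p R k \<equiv> burst_counter g lmin (cost A) (history X p R k)"

definition pendc :: "real \<Rightarrow> real \<Rightarrow> nat set" where
  "pendc c t = {\<tau> \<in> pend t. cost A \<tau> = c}"

definition queue :: "real \<Rightarrow> real \<Rightarrow> nat list" where
  "queue c t = sort_key (arr A) (sorted_list_of_set (pendc c t))"

text \<open>\<open>X\<close> is constrained only at processors in \<open>{1..n}\<close> and at their
  runs, so these conditions are bundled with the entry. The cycle may still be cut off by a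
  crash.\<close>

definition cyc :: "nat \<Rightarrow> real \<times> ereal \<Rightarrow> nat \<Rightarrow> real \<Rightarrow> nat \<Rightarrow> bool" where
  "cyc p R k \<sigma> \<tau> \<longleftrightarrow> p \<in> {1..n} \<and> R \<in> runs A p \<and> X p R k = Some (\<sigma>, \<tau>)"

lemma lmax_pos: "0 < lmax"
  using lmin_pos lmin_lmax by simp

lemma finite_arrived: "finite {\<tau> \<in> inj A. arr A \<tau> \<le> t}"
  using wf by (simp add: wf_pattern_def)

lemma cost_cases: "\<tau> \<in> inj A \<Longrightarrow> cost A \<tau> = lmin \<or> cost A \<tau> = lmax"
  using wf by (simp add: wf_pattern_def)

lemma finite_pending: "finite (pending A Q t)"
  by (rule finite_subset[OF _ finite_arrived[of t]]) (auto simp: pending_def)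

lemma finite_pendc: "finite (pendc c t)"
  using finite_pending by (simp add: pendc_def)

lemma runs_disjoint:
  assumes "R \<in> runs A p" "R' \<in> runs A p" "R \<noteq> R'"
  shows "snd R \<le> ereal (fst R') \<or> snd R' \<le> ereal (fst R)"
proof -
  have "\<forall>(b, e)\<in>runs A p. \<forall>(b', e')\<in>runs A p.
          (b, e) \<noteq> (b', e') \<longrightarrow> e \<le> ereal b' \<or> e' \<le> ereal b"
    using wf by (simp add: wf_pattern_def)
  from bspec[OF bspec[OF this assms(1), unfolded case_prod_beta] assms(2)] assms(3)
  show ?thesis by simp
qed

lemma set_queue: "set (queue c t) = pendc c t"
  using finite_pendc by (simp add: queue_def)

lemma length_queue: "length (queue c t) = card (pendc c t)"
  by (simp add: queue_def)

lemma card_earlier_queue: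
  assumes "i < card (pendc c t)"
  shows "card {x \<in> pendc c t. earlier (arr A) x (queue c t ! i)} = i"
proof -
  have "sorted_wrt (earlier (arr A)) (queue c t)"
    unfolding queue_def by (intro sorted_wrt_earlier_sort_key) simp
  from card_earlier_nth[OF this, of i] show ?thesis
    using assms by (simp add: length_queue set_queue)
qed

lemma cyc_start:
  assumes "cyc p R k \<sigma> \<tau>"
  obtains r where "ready_time s A X p R k = Some r" "r \<le> \<sigma>" "ereal \<sigma> < snd R" "pend \<sigma> \<noteq> {}"
    "\<And>t. r \<le> t \<Longrightarrow> t < \<sigma> \<Longrightarrow> pend t = {}"
    "\<tau> = burst_choice n g lmin lmax A p (history X p R k) (pend \<sigma>)"
proof -
  obtain b e where R: "R = (b, e)" by (cases R)
  have p: "p \<in> {1..n}" "(b, e) \<in> runs A p" and X: "X p (b, e) k = Some (\<sigma>, \<tau>)"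
    using assms by (auto simp: cyc_def R)
  have "case ready_time s A X p (b, e) k of
          None \<Rightarrow> X p (b, e) k = None
        | Some r \<Rightarrow>
            (if \<exists>t. r \<le> t \<and> ereal t < e \<and> pend t \<noteq> {} then
               (\<exists>\<sigma>. r \<le> \<sigma> \<and> ereal \<sigma> < e \<and> pend \<sigma> \<noteq> {} \<and>
                    (\<forall>t. r \<le> t \<and> t < \<sigma> \<longrightarrow> pend t = {}) \<and>
                    X p (b, e) k = Some (\<sigma>, burst_choice n g lmin lmax A p
                                             (history X p (b, e) k) (pend \<sigma>)))
             else X p (b, e) k = None)"
    using exec p unfolding burst_exec_def Let_def by blast
  then show thesis
    using X that by (auto simp: R split: option.splits if_splits)
qed

text \<open>A living processor that is ready waits only through times with an empty pending set, so
  a time \<open>t\<close> with pending tasks ends the wait.\<close>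

lemma cyc_exists:
  assumes "p \<in> {1..n}" "R \<in> runs A p" "ready_time s A X p R k = Some r" "r \<le> t"
    "ereal t < snd R" "pend t \<noteq> {}"
  obtains \<sigma> \<tau> where "cyc p R k \<sigma> \<tau>" "r \<le> \<sigma>" "\<sigma> \<le> t"
proof -
  obtain b e where R: "R = (b, e)" by (cases R)
  have "case ready_time s A X p (b, e) k of
          None \<Rightarrow> X p (b, e) k = None
        | Some r \<Rightarrow>
            (if \<exists>t. r \<le> t \<and> ereal t < e \<and> pend t \<noteq> {} then
               (\<exists>\<sigma>. r \<le> \<sigma> \<and> ereal \<sigma> < e \<and> pend \<sigma> \<noteq> {} \<and>
                    (\<forall>t. r \<le> t \<and> t < \<sigma> \<longrightarrow> pend t = {}) \<and>
                    X p (b, e) k = Some (\<sigma>, burst_choice n g lmin lmax A p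
                                             (history X p (b, e) k) (pend \<sigma>)))
             else X p (b, e) k = None)"
    using exec assms(1,2) unfolding burst_exec_def Let_def R by blast
  moreover have "\<exists>t. r \<le> t \<and> ereal t < e \<and> pend t \<noteq> {}" using assms R by auto
  ultimately obtain \<sigma> \<tau> where
    "r \<le> \<sigma>" "\<forall>t. r \<le> t \<and> t < \<sigma> \<longrightarrow> pend t = {}" "X p (b, e) k = Some (\<sigma>, \<tau>)"
    using assms(3) unfolding R by auto
  moreover from this have "\<sigma> \<le> t" using assms(4,6) by force
  ultimately show thesis using that assms(1,2) by (auto simp: cyc_def R)
qed

lemma idx_less:
  assumes "p \<in> {1..n}" "n^2 \<le> m"
  shows "p * n - 1 < m"
proof -
  have "p * n \<le> n * n" using assms(1) by simp
  moreover have "0 < p * n" using assms(1) n_pos by simp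
  ultimately show ?thesis using assms(2) unfolding power2_eq_square by linarith
qed

lemma choice_eq:
  "burst_choice n g lmin lmax A p hist (pend t) =
    (let Lmin = queue lmin t; Lmax = queue lmax t; c = burst_counter g lmin (cost A) hist;
         prev_min = (hist \<noteq> [] \<and> cost A (last hist) = lmin)
     in if length Lmin < n^2 \<and> length Lmax < n^2 then
          (if prev_min then
             (if Lmax \<noteq> [] then Lmax ! (p * n mod length Lmax) else Lmin ! (p * n mod length Lmin))
           else
             (if Lmin \<noteq> [] then Lmin ! (p * n mod length Lmin) else Lmax ! (p * n mod length Lmax)))
        else if n^2 \<le> length Lmin \<and> length Lmax < n^2 then Lmin ! (p * n - 1)
        else if length Lmin < n^2 \<and> n^2 \<le> length Lmax then Lmax ! (p * n - 1)
        else if c = g then Lmax ! (p * n - 1) else Lmin ! (p * n - 1))"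
  unfolding burst_choice_def queue_def pendc_def ..

lemma pend_cases: "pend t = pendc lmin t \<union> pendc lmax t"
  using cost_cases by (auto simp: pendc_def pending_def)

text \<open>Every branch of the choice uses a valid index: a residue modulo the length of a nonempty
  list in Case 1, where an empty preferred list hands over to the other one, and otherwise
  \<open>p * n - 1\<close> in a list with at least \<open>n^2\<close> entries.\<close>

lemma cyc_in_pend:
  assumes "cyc p R k \<sigma> \<tau>"
  shows "\<tau> \<in> pend \<sigma>"
proof -
  obtain r where ne: "pend \<sigma> \<noteq> {}"
    and \<tau>: "\<tau> = burst_choice n g lmin lmax A p (history X p R k) (pend \<sigma>)"
    using assms by (rule cyc_start)
  have p: "p \<in> {1..n}" using assms by (simp add: cyc_def)
  have ne': "queue lmin \<sigma> \<noteq> [] \<or> queue lmax \<sigma> \<noteq> []"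
    using ne pend_cases[of \<sigma>] set_queue[of _ \<sigma>] by (metis Un_empty set_empty)
  define hist where "hist = history X p R k"
  define Lmin Lmax where L: "Lmin = queue lmin \<sigma>" "Lmax = queue lmax \<sigma>"
  have mod: "Lmin \<noteq> [] \<Longrightarrow> Lmin ! (p * n mod length Lmin) \<in> set Lmin"
    "Lmax \<noteq> [] \<Longrightarrow> Lmax ! (p * n mod length Lmax) \<in> set Lmax" by simp_all
  have idx: "n^2 \<le> length Lmin \<Longrightarrow> Lmin ! (p * n - 1) \<in> set Lmin"
    "n^2 \<le> length Lmax \<Longrightarrow> Lmax ! (p * n - 1) \<in> set Lmax"
    using idx_less[OF p] by simp_all
  have "\<tau> \<in> set Lmin \<or> \<tau> \<in> set Lmax"
    unfolding \<tau> choice_eq hist_def[symmetric] L[symmetric] Let_def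
    using ne'[folded L] mod idx by (auto simp: not_less)
  then have "\<tau> \<in> set (queue lmin \<sigma>) \<union> set (queue lmax \<sigma>)" by (simp add: L)
  then show ?thesis by (simp add: set_queue pend_cases)
qed

lemma cyc_cost:
  assumes "cyc p R k \<sigma> \<tau>"
  shows "cost A \<tau> = lmin \<or> cost A \<tau> = lmax" "0 < cost A \<tau>" "\<sigma> < fin \<sigma> \<tau>"
    "cost A \<tau> \<le> lmax" "lmin \<le> cost A \<tau>"
proof -
  show "cost A \<tau> = lmin \<or> cost A \<tau> = lmax"
    using cyc_in_pend[OF assms] cost_cases by (auto simp: pending_def)
  then show "0 < cost A \<tau>" "cost A \<tau> \<le> lmax" "lmin \<le> cost A \<tau>" using lmin_pos lmin_lmax by auto
  then show "\<sigma> < fin \<sigma> \<tau>" using s_gt1 by simp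
qed

lemma cyc_unique: "cyc p R k \<sigma> \<tau> \<Longrightarrow> cyc p R k \<sigma>' \<tau>' \<Longrightarrow> \<sigma> = \<sigma>' \<and> \<tau> = \<tau>'"
  by (simp add: cyc_def)

lemma ready_0: "ready_time s A X p R 0 = Some (fst R)"
  by (simp add: ready_time_def)

lemma ready_Suc:
  "cyc p R k \<sigma> \<tau> \<Longrightarrow> ereal (fin \<sigma> \<tau>) < snd R \<Longrightarrow>
    ready_time s A X p R (Suc k) = Some (fin \<sigma> \<tau>)"
  by (simp add: ready_time_def cyc_def)

lemma cyc_SucE:
  assumes "cyc p R (Suc k) \<sigma>' \<tau>'"
  obtains \<sigma> \<tau> where "cyc p R k \<sigma> \<tau>" "ereal (fin \<sigma> \<tau>) < snd R" "fin \<sigma> \<tau> \<le> \<sigma>'"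
    "\<And>t. fin \<sigma> \<tau> \<le> t \<Longrightarrow> t < \<sigma>' \<Longrightarrow> pend t = {}"
proof -
  obtain r where r: "ready_time s A X p R (Suc k) = Some r" "r \<le> \<sigma>'"
    "\<And>t. r \<le> t \<Longrightarrow> t < \<sigma>' \<Longrightarrow> pend t = {}"
    using assms by (rule cyc_start) blast
  from r(1) obtain \<sigma> \<tau> where "X p R k = Some (\<sigma>, \<tau>)"
    by (auto simp: ready_time_def split: option.splits)
  then have "cyc p R k \<sigma> \<tau>" using assms by (simp add: cyc_def)
  moreover from this r(1) have "ereal (fin \<sigma> \<tau>) < snd R" "r = fin \<sigma> \<tau>"
    by (auto simp: ready_time_def cyc_def split: if_splits)
  ultimately show thesis using that r(2,3) by blast
qed

lemma cyc_less:
  assumes "cyc p R j \<sigma>' \<tau>'" "i < j"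
  obtains \<sigma> \<tau> where "cyc p R i \<sigma> \<tau>" "ereal (fin \<sigma> \<tau>) < snd R" "fin \<sigma> \<tau> \<le> \<sigma>'"
  using assms
proof (induction j arbitrary: \<sigma>' \<tau>' thesis)
  case 0
  then show ?case by simp
next
  case (Suc j)
  obtain \<sigma>1 \<tau>1 where 1: "cyc p R j \<sigma>1 \<tau>1" "ereal (fin \<sigma>1 \<tau>1) < snd R" "fin \<sigma>1 \<tau>1 \<le> \<sigma>'"
    using Suc.prems(2) by (rule cyc_SucE)
  show ?case
  proof (cases "i = j")
    case True
    with 1 Suc.prems(1) show ?thesis by blast
  next
    case False
    with Suc.prems(3) have "i < j" by simp
    from Suc.IH[OF _ 1(1) this] obtain \<sigma> \<tau> where
      2: "cyc p R i \<sigma> \<tau>" "ereal (fin \<sigma> \<tau>) < snd R" "fin \<sigma> \<tau> \<le> \<sigma>1" by blast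
    have "\<sigma>1 < fin \<sigma>1 \<tau>1" using cyc_cost(3)[OF 1(1)] .
    with 1 2 have "fin \<sigma> \<tau> \<le> \<sigma>'" by linarith
    with 2 Suc.prems(1) show ?thesis by blast
  qed
qed

text \<open>Every completed cycle lasts at least \<open>lmin / s\<close>. This excludes infinitely
  many cycles of a run before a given time.\<close>

lemma cyc_start_ge:
  assumes "cyc p R k \<sigma> \<tau>"
  shows "fst R + real k * (lmin / s) \<le> \<sigma>"
  using assms
proof (induction k arbitrary: \<sigma> \<tau>)
  case 0
  then obtain r where "ready_time s A X p R 0 = Some r" "r \<le> \<sigma>" by (rule cyc_start)
  then show ?case by (simp add: ready_0)
next
  case (Suc k)
  obtain \<sigma>1 \<tau>1 where 1: "cyc p R k \<sigma>1 \<tau>1" "fin \<sigma>1 \<tau>1 \<le> \<sigma>"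
    using Suc.prems by (rule cyc_SucE)
  have "lmin / s \<le> cost A \<tau>1 / s"
    using cyc_cost(5)[OF 1(1)] s_gt1 by (simp add: divide_right_mono)
  with 1 Suc.IH[OF 1(1)] show ?case by (simp add: algebra_simps)
qed

lemma cyc_fst_le:
  assumes "cyc p R k \<sigma> \<tau>"
  shows "fst R \<le> \<sigma>"
proof -
  have "0 \<le> real k * (lmin / s)" using lmin_pos s_gt1 by simp
  then show ?thesis using cyc_start_ge[OF assms] by linarith
qed

lemma reports_iff:
  "(\<tau>, f) \<in> Rep \<longleftrightarrow> (\<exists>p R k \<sigma>. cyc p R k \<sigma> \<tau> \<and> f = fin \<sigma> \<tau> \<and> ereal f < snd R)"
proof
  assume "(\<tau>, f) \<in> Rep"
  then obtain p b e k \<sigma> where "p \<in> {1..n}" "(b, e) \<in> runs A p" "X p (b, e) k = Some (\<sigma>, \<tau>)"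
    "f = fin \<sigma> \<tau>" "ereal f < e"
    unfolding reports_def by blast
  then show "\<exists>p R k \<sigma>. cyc p R k \<sigma> \<tau> \<and> f = fin \<sigma> \<tau> \<and> ereal f < snd R"
    by (intro exI[of _ p] exI[of _ "(b, e)"] exI[of _ k] exI[of _ \<sigma>]) (simp add: cyc_def)
next
  assume "\<exists>p R k \<sigma>. cyc p R k \<sigma> \<tau> \<and> f = fin \<sigma> \<tau> \<and> ereal f < snd R"
  then obtain p b e k \<sigma> where "cyc p (b, e) k \<sigma> \<tau>" "f = fin \<sigma> \<tau>" "ereal f < e"
    by auto
  then show "(\<tau>, f) \<in> Rep"
    unfolding reports_def cyc_def by blast
qed

text \<open>Within a run, a cycle starts only after the previous one has ended; different runs of a
  processor do not overlap. Completion matters: a cycle cut off by a crash may nominally reach into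
  the next run.\<close>

lemma cyc_disjoint:
  assumes "cyc p R k \<sigma> \<tau>" "ereal (fin \<sigma> \<tau>) < snd R"
    and "cyc p R' k' \<sigma>' \<tau>'" "ereal (fin \<sigma>' \<tau>') < snd R'" and "(R, k) \<noteq> (R', k')"
  shows "fin \<sigma> \<tau> \<le> \<sigma>' \<or> fin \<sigma>' \<tau>' \<le> \<sigma>"
proof (cases "R = R'")
  case True
  with assms(5) consider "k < k'" | "k' < k" by fastforce
  then show ?thesis
  proof cases
    case 1
    from cyc_less[OF assms(3) 1] assms(1) True show ?thesis by (metis cyc_unique)
  next
    case 2
    from cyc_less[OF assms(1) 2] assms(3) True show ?thesis by (metis cyc_unique)
  qed
next
  case False
  have "R \<in> runs A p" "R' \<in> runs A p" using assms by (auto simp: cyc_def)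
  from runs_disjoint[OF this False] show ?thesis
  proof
    assume "snd R \<le> ereal (fst R')"
    with assms(2) have "fin \<sigma> \<tau> \<le> fst R'" by (metis ereal_less_eq(3) less_imp_le order_less_le_trans)
    with cyc_fst_le[OF assms(3)] show ?thesis by linarith
  next
    assume "snd R' \<le> ereal (fst R)"
    with assms(4) have "fin \<sigma>' \<tau>' \<le> fst R" by (metis ereal_less_eq(3) less_imp_le order_less_le_trans)
    with cyc_fst_le[OF assms(1)] show ?thesis by linarith
  qed
qed

text \<open>Only pending tasks are picked, and a report at time \<open>\<sigma>'\<close> already
  removes the task from \<open>pend \<sigma>'\<close>, hence the strict inequality.\<close>

lemma cyc_not_reported:
  assumes "cyc p R k \<sigma> \<tau>" "cyc p' R' k' \<sigma>' \<tau>" "ereal (fin \<sigma> \<tau>) < snd R"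
  shows "\<sigma>' < fin \<sigma> \<tau>"
proof -
  have "(\<tau>, fin \<sigma> \<tau>) \<in> Rep" unfolding reports_iff using assms(1,3) by blast
  moreover have "\<not> (\<exists>f\<le>\<sigma>'. (\<tau>, f) \<in> Rep)"
    using cyc_in_pend[OF assms(2)] by (simp add: pending_def)
  ultimately show ?thesis using not_le by blast
qed

section \<open>Long queues prevent duplicated work\<close>

text \<open>The pick made in Cases 2 to 4, in contrast to the modular index of Case 1, which may
  coincide for several processors.\<close>

definition good :: "nat \<Rightarrow> real \<Rightarrow> nat \<Rightarrow> bool" where
  "good p \<sigma> \<tau> \<longleftrightarrow> n^2 \<le> card (pendc (cost A \<tau>) \<sigma>) \<and> \<tau> = queue (cost A \<tau>) \<sigma> ! (p * n - 1)"

text \<open>While a processor executes a task, every other processor removes at most one task of the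
  same cost, so the task's position drops by at most n - 1 and stays between (p - 1) n and p n - 1.\<close>

lemma good_same_processor:
  assumes 1: "cyc p R k \<sigma> \<tau>" "ereal (fin \<sigma> \<tau>) < snd R" "good p \<sigma> \<tau>"
    and 2: "cyc p' R' k' \<sigma>' \<tau>" "good p' \<sigma>' \<tau>" and le: "\<sigma> \<le> \<sigma>'"
  shows "p = p'"
proof -
  let ?c = "cost A \<tau>"
  define B where "B t = {x \<in> pendc ?c t. earlier (arr A) x \<tau>}" for t
  have p: "p \<in> {1..n}" "p' \<in> {1..n}" using 1 2 by (auto simp: cyc_def)
  have cB: "card (B \<sigma>) = p * n - 1"
    using card_earlier_queue[OF idx_less[OF p(1)], of ?c \<sigma>] 1(3) unfolding good_def B_def by simp
  have cB': "card (B \<sigma>') = p' * n - 1"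
    using card_earlier_queue[OF idx_less[OF p(2)], of ?c \<sigma>'] 2(2) unfolding good_def B_def by simp
  have fB: "finite (B t)" for t using finite_pendc by (simp add: B_def)
  have lt: "\<sigma>' < \<sigma> + ?c / s" using cyc_not_reported[OF 1(1) 2(1) 1(2)] .
  have arr\<tau>: "arr A \<tau> \<le> \<sigma>" using cyc_in_pend[OF 1(1)] by (simp add: pending_def)
  \<comment> \<open>Tasks arriving after \<open>\<sigma>\<close> rank behind \<open>\<tau>\<close>,
    so predecessors can only disappear.\<close>
  have "B \<sigma>' \<subseteq> B \<sigma>"
    using le arr\<tau> by (auto simp: B_def pendc_def pending_def earlier_def)
  \<comment> \<open>A processor responsible for the disappearance of \<open>x\<close>: it reports
    \<open>x\<close> after \<open>\<sigma>\<close> and no later than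
    \<open>\<sigma>'\<close>.\<close>
  define q where "q x = (SOME q. \<exists>R k \<sigma>1. cyc q R k \<sigma>1 x \<and> ereal (fin \<sigma>1 x) < snd R
      \<and> \<sigma> < fin \<sigma>1 x \<and> fin \<sigma>1 x \<le> \<sigma>')" for x
  have q: "\<exists>R k \<sigma>1. cyc (q x) R k \<sigma>1 x \<and> ereal (fin \<sigma>1 x) < snd R
      \<and> \<sigma> < fin \<sigma>1 x \<and> fin \<sigma>1 x \<le> \<sigma>'" if x: "x \<in> B \<sigma> - B \<sigma>'" for x
  proof -
    from x have "\<not> (\<exists>f\<le>\<sigma>. (x, f) \<in> Rep)" by (auto simp: B_def pendc_def pending_def)
    moreover from x have "\<exists>f\<le>\<sigma>'. (x, f) \<in> Rep"
      using le by (auto simp: B_def pendc_def pending_def)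
    ultimately have "\<exists>q R k \<sigma>1. cyc q R k \<sigma>1 x \<and> ereal (fin \<sigma>1 x) < snd R
      \<and> \<sigma> < fin \<sigma>1 x \<and> fin \<sigma>1 x \<le> \<sigma>'"
      unfolding reports_iff by (metis not_le)
    then show ?thesis unfolding q_def by (rule someI_ex)
  qed
  have cx: "cost A x = ?c" if "x \<in> B \<sigma>" for x using that by (simp add: B_def pendc_def)
  \<comment> \<open>Of two reports by one processor, the second would need an execution of length
    \<open>?c / s\<close> inside the window from \<open>\<sigma>\<close> to
    \<open>\<sigma>'\<close>, which is shorter than that.\<close>
  have "inj_on q (B \<sigma> - B \<sigma>')"
  proof (rule inj_onI, rule ccontr)
    fix x y assume xy: "x \<in> B \<sigma> - B \<sigma>'" "y \<in> B \<sigma> - B \<sigma>'" "q x = q y" "x \<noteq> y"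
    from q[OF xy(1)] obtain R1 k1 \<sigma>1 where x: "cyc (q x) R1 k1 \<sigma>1 x"
      "ereal (fin \<sigma>1 x) < snd R1" "\<sigma> < fin \<sigma>1 x" "fin \<sigma>1 x \<le> \<sigma>'" by blast
    from q[OF xy(2)] obtain R2 k2 \<sigma>2 where y: "cyc (q x) R2 k2 \<sigma>2 y"
      "ereal (fin \<sigma>2 y) < snd R2" "\<sigma> < fin \<sigma>2 y" "fin \<sigma>2 y \<le> \<sigma>'" using xy(3) by auto
    have "(R1, k1) \<noteq> (R2, k2)" using x y xy(4) cyc_unique by blast
    from cyc_disjoint[OF x(1,2) y(1,2) this] x y lt cx[of x] cx[of y] xy show False by auto
  qed
  moreover have "q ` (B \<sigma> - B \<sigma>') \<subseteq> {1..n} - {p}"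
  proof
    fix z assume "z \<in> q ` (B \<sigma> - B \<sigma>')"
    then obtain x where x: "x \<in> B \<sigma> - B \<sigma>'" "z = q x" by blast
    from q[OF x(1)] obtain R1 k1 \<sigma>1 where c: "cyc (q x) R1 k1 \<sigma>1 x"
      "ereal (fin \<sigma>1 x) < snd R1" "\<sigma> < fin \<sigma>1 x" "fin \<sigma>1 x \<le> \<sigma>'" by blast
    \<comment> \<open>Processor \<open>p\<close> itself is occupied by \<open>\<tau>\<close> during
      the whole window.\<close>
    have "q x \<noteq> p"
    proof
      assume "q x = p"
      have "x \<noteq> \<tau>" using x(1) by (auto simp: B_def earlier_def)
      then have "(R, k) \<noteq> (R1, k1)" using c(1) 1(1) \<open>q x = p\<close> cyc_unique by blast
      moreover have "0 < cost A x / s" using cyc_cost(2)[OF c(1)] s_gt1 by simp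
      ultimately show False
        using cyc_disjoint[OF 1(1,2), of R1 k1 \<sigma>1 x] c \<open>q x = p\<close> lt cyc_cost(3)[OF 1(1)] by auto
    qed
    then show "z \<in> {1..n} - {p}" using c(1) x(2) by (auto simp: cyc_def)
  qed
  ultimately have "card (B \<sigma> - B \<sigma>') \<le> card ({1..n} - {p})"
    by (intro card_inj_on_le[where f = q]) auto
  also have "\<dots> = n - 1" using p by simp
  finally have "card (B \<sigma>) \<le> card (B \<sigma>') + (n - 1)"
    using card_Diff_subset[OF fB \<open>B \<sigma>' \<subseteq> B \<sigma>\<close>] by linarith
  moreover have "card (B \<sigma>') \<le> card (B \<sigma>)" using \<open>B \<sigma>' \<subseteq> B \<sigma>\<close> fB by (intro card_mono)
  moreover have "1 \<le> p * n" "1 \<le> p' * n" using p n_pos by auto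
  \<comment> \<open>Both positions are one less than a multiple of \<open>n\<close>, and a drop of
    at most \<open>n - 1\<close> leaves no room for a different multiple.\<close>
  ultimately have "p' * n \<le> p * n" "p * n < p' * n + n"
    using cB cB' n_pos by linarith+
  then have "p' * n \<le> p * n" "p * n < Suc p' * n" by simp_all
  then show ?thesis using n_pos unfolding mult_le_cancel2 mult_less_cancel2 by simp
qed

text \<open>\<open>good_same_processor\<close> needs the cycles ordered by start, so it is used in
  both orders. On one processor distinct completed cycles are disjoint, and the later one would find
  the task already reported.\<close>

lemma good_disjoint:
  assumes "cyc p R k \<sigma> \<tau>" "ereal (fin \<sigma> \<tau>) < snd R" "good p \<sigma> \<tau>"
    and "cyc p' R' k' \<sigma>' \<tau>" "ereal (fin \<sigma>' \<tau>) < snd R'" "good p' \<sigma>' \<tau>"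
  shows "p = p' \<and> R = R' \<and> k = k'"
proof -
  have "p = p'" using good_same_processor[OF assms(1-3) assms(4,6)] good_same_processor[OF assms(4-6) assms(1,3)] by linarith
  moreover have "(R, k) = (R', k')"
  proof (rule ccontr)
    assume "(R, k) \<noteq> (R', k')"
    from cyc_disjoint[OF assms(1,2) _ assms(5) this] show False
      using assms \<open>p = p'\<close> cyc_not_reported[OF assms(1,4,2)] cyc_not_reported[OF assms(4,1,5)] by auto
  qed
  ultimately show ?thesis by simp
qed

section \<open>The counter and the choice at a long queue\<close>

lemma burst_counter_le: "burst_counter k l c hist \<le> k"
  by (induction hist rule: rev_induct) (auto simp: burst_counter_def)

lemma cnt_0: "cnt p R 0 = 0"
  by (simp add: burst_counter_def history_def)

lemma cnt_Suc:
  "cyc p R k \<sigma> \<tau> \<Longrightarrow> cnt p R (Suc k) = (if cost A \<tau> = lmin then min (cnt p R k + 1) g else 0)"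
  by (simp add: burst_counter_def history_def cyc_def)

lemma queue_nth_cost:
  assumes "p \<in> {1..n}" "n^2 \<le> card (pendc c t)"
  shows "cost A (queue c t ! (p * n - 1)) = c"
proof -
  have "queue c t ! (p * n - 1) \<in> set (queue c t)"
    using idx_less[OF assms] by (simp add: length_queue)
  then show ?thesis by (simp add: set_queue pendc_def)
qed

text \<open>Only Cases 2 and 4 remain, and an lmax-task is picked only in Case 4 with a full
  counter. The disjunction on costs becomes the relation \<open>allow\<close> for the
  lmin-queue.\<close>

lemma pick_min:
  assumes "cyc p R k \<sigma> \<tau>" "n^2 \<le> card (pendc lmin \<sigma>)"
  shows "good p \<sigma> \<tau> \<and> (cost A \<tau> = lmin \<or> cost A \<tau> = lmax \<and> cnt p R k = g)"
proof -
  obtain r where \<tau>: "\<tau> = burst_choice n g lmin lmax A p (history X p R k) (pend \<sigma>)"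
    using assms(1) by (rule cyc_start)
  have p: "p \<in> {1..n}" using assms by (simp add: cyc_def)
  have "\<tau> = queue lmin \<sigma> ! (p * n - 1) \<or>
    \<tau> = queue lmax \<sigma> ! (p * n - 1) \<and> n^2 \<le> card (pendc lmax \<sigma>) \<and> cnt p R k = g"
    using assms(2) unfolding \<tau> choice_eq Let_def length_queue by (simp add: not_less)
  then show ?thesis
    using queue_nth_cost[OF p] assms(2) by (auto simp: good_def)
qed

text \<open>Cases 3 and 4 remain. As the counter never exceeds \<open>g\<close>, Case 4 picks an
  lmin-task only strictly below \<open>g\<close>.\<close>

lemma pick_max:
  assumes "cyc p R k \<sigma> \<tau>" "n^2 \<le> card (pendc lmax \<sigma>)"
  shows "good p \<sigma> \<tau> \<and> (cost A \<tau> = lmax \<or> cost A \<tau> = lmin \<and> cnt p R k < g)"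
proof -
  obtain r where \<tau>: "\<tau> = burst_choice n g lmin lmax A p (history X p R k) (pend \<sigma>)"
    using assms(1) by (rule cyc_start)
  have p: "p \<in> {1..n}" using assms by (simp add: cyc_def)
  have "\<tau> = queue lmax \<sigma> ! (p * n - 1) \<or>
    \<tau> = queue lmin \<sigma> ! (p * n - 1) \<and> n^2 \<le> card (pendc lmin \<sigma>) \<and> cnt p R k \<noteq> g"
    using assms(2) unfolding \<tau> choice_eq Let_def length_queue by (simp add: not_less)
  moreover have "cnt p R k \<le> g" by (rule burst_counter_le)
  ultimately show ?thesis
    using queue_nth_cost[OF p] assms(2) by (auto simp: good_def)
qed

end

section \<open>Progress of a single run while a queue stays long\<close>

text \<open>The counter k of the algorithm is turned into a potential pot k: between t0 and t, a run
  finishes at least one task with cost in cls per l time units, up to the change of the potential.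
  The predicate allow k w collects the costs w that may be picked in state k.\<close>

locale phase = burst +
  fixes t0 t c l :: real and pot :: "nat \<Rightarrow> real" and cls :: "real \<Rightarrow> bool"
    and allow :: "nat \<Rightarrow> real \<Rightarrow> bool"
  assumes t0_le: "t0 \<le> t"
    and busy: "\<And>w. t0 \<le> w \<Longrightarrow> w \<le> t \<Longrightarrow> n^2 \<le> card (pendc c w)"
    and pick: "\<And>p R k \<sigma> \<tau>. cyc p R k \<sigma> \<tau> \<Longrightarrow> n^2 \<le> card (pendc c \<sigma>) \<Longrightarrow>
      good p \<sigma> \<tau> \<and> allow (cnt p R k) (cost A \<tau>)"
    and step: "\<And>k w. allow k w \<Longrightarrow> k \<le> g \<Longrightarrow> w = lmin \<or> w = lmax \<Longrightarrow>
      pot (if w = lmin then min (k + 1) g else 0) + w / s \<le> pot k + (if cls w then l else 0)"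
    and last_step: "\<And>k w. allow k w \<Longrightarrow> k \<le> g \<Longrightarrow> w = lmin \<or> w = lmax \<Longrightarrow> w / s \<le> pot k + l"
    and pot_0: "pot 0 = 0"
    and pot_cross: "\<And>k. k \<le> g \<Longrightarrow> lmin / s + pot k \<le> lmax / s"
    and l_pos: "0 < l"
    and l_le: "\<And>w. cls w \<Longrightarrow> w = lmin \<or> w = lmax \<Longrightarrow> l \<le> w"
begin

definition started :: "nat \<Rightarrow> real \<times> ereal \<Rightarrow> nat \<Rightarrow> nat set" where
  "started p R k = {i. i < k \<and> (\<exists>\<sigma> \<tau>. cyc p R i \<sigma> \<tau> \<and> t0 \<le> \<sigma> \<and> cls (cost A \<tau>))}"

text \<open>Tasks rather than cycle indices are collected, so that contributions of different runs
  can be united; \<open>started\<close> uses indices because \<open>start_bound\<close> proceeds by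
  induction over cycles.\<close>

definition finished :: "nat \<Rightarrow> real \<times> ereal \<Rightarrow> real \<Rightarrow> nat set" where
  "finished p R L = {\<tau>. \<exists>k \<sigma>. cyc p R k \<sigma> \<tau> \<and> t0 \<le> \<sigma> \<and> fin \<sigma> \<tau> \<le> L \<and>
     ereal (fin \<sigma> \<tau>) < snd R \<and> cls (cost A \<tau>)}"

text \<open>In a run already under way at t0, a task started earlier may delay the first counted
  one by up to lmax / s.\<close>

definition base :: "real \<times> ereal \<Rightarrow> real" where
  "base R = (if t0 \<le> fst R then fst R else t0 + lmax / s)"

lemma pend_ne: "t0 \<le> w \<Longrightarrow> w \<le> t \<Longrightarrow> pend w \<noteq> {}"
proof -
  assume "t0 \<le> w" "w \<le> t"
  then have "n^2 \<le> card (pendc c w)" by (rule busy)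
  moreover have "0 < n^2" using n_pos by simp
  ultimately have "pendc c w \<noteq> {}" by (metis card.empty not_le)
  then show ?thesis by (auto simp: pendc_def)
qed

lemma cnt_le: "cnt p R k \<le> g"
  by (rule burst_counter_le)

lemma started_Suc:
  assumes "cyc p R k \<sigma> \<tau>" "t0 \<le> \<sigma>"
  shows "card (started p R (Suc k)) = card (started p R k) + (if cls (cost A \<tau>) then 1 else 0)"
proof -
  have "started p R (Suc k) = (if cls (cost A \<tau>) then insert k (started p R k) else started p R k)"
    using assms by (auto simp: started_def less_Suc_eq cyc_def)
  moreover have "finite (started p R k)" "k \<notin> started p R k" by (auto simp: started_def)
  ultimately show ?thesis by simp
qed

text \<open>Start time plus potential is the invariant: \<open>step\<close> pays for each cycle from
  the potential, and with \<open>l\<close> if its task is counted. No time is lost, since a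
  processor never idles while the queue is long.\<close>

lemma start_bound:
  assumes "cyc p R k \<sigma> \<tau>" "t0 \<le> \<sigma>" "\<sigma> \<le> t"
  shows "\<sigma> + pot (cnt p R k) \<le> base R + real (card (started p R k)) * l"
  using assms
proof (induction k arbitrary: \<sigma> \<tau>)
  case 0
  from 0(1) obtain r where "ready_time s A X p R 0 = Some r" "r \<le> \<sigma>"
    "\<And>t. r \<le> t \<Longrightarrow> t < \<sigma> \<Longrightarrow> pend t = {}" by (rule cyc_start) blast
  then have r: "fst R \<le> \<sigma>" "\<And>t. fst R \<le> t \<Longrightarrow> t < \<sigma> \<Longrightarrow> pend t = {}"
    by (simp_all add: ready_0)
  have "0 < lmax / s" using lmax_pos s_gt1 by simp
  moreover have "\<sigma> = max t0 (fst R)"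
    using r(2)[of "max t0 (fst R)"] pend_ne[of "max t0 (fst R)"] r(1) 0(2,3) by force
  ultimately have "\<sigma> \<le> base R" by (auto simp: base_def)
  then show ?case unfolding cnt_0 pot_0 by (simp add: started_def)
next
  case (Suc k)
  from Suc.prems(1) obtain \<sigma>1 \<tau>1 where 1: "cyc p R k \<sigma>1 \<tau>1" "fin \<sigma>1 \<tau>1 \<le> \<sigma>"
    and idle: "\<And>t. fin \<sigma>1 \<tau>1 \<le> t \<Longrightarrow> t < \<sigma> \<Longrightarrow> pend t = {}" by (rule cyc_SucE) blast
  have \<sigma>: "\<sigma> = max t0 (fin \<sigma>1 \<tau>1)"
    using idle[of "max t0 (fin \<sigma>1 \<tau>1)"] pend_ne[of "max t0 (fin \<sigma>1 \<tau>1)"] 1(2) Suc.prems(2,3)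
    by force
  have pos: "0 < lmin / s" using lmin_pos s_gt1 by simp
  show ?case
  proof (cases "t0 \<le> \<sigma>1")
    case True
    have le: "\<sigma>1 < fin \<sigma>1 \<tau>1" "\<sigma>1 \<le> t" using cyc_cost(3)[OF 1(1)] 1(2) Suc.prems(3) by auto
    then have "\<sigma> = fin \<sigma>1 \<tau>1" using \<sigma> True by simp
    moreover have "allow (cnt p R k) (cost A \<tau>1)"
      using pick[OF 1(1)] busy[OF True le(2)] by simp
    from step[OF this cnt_le cyc_cost(1)[OF 1(1)]]
    have "pot (cnt p R (Suc k)) + cost A \<tau>1 / s
        \<le> pot (cnt p R k) + (if cls (cost A \<tau>1) then l else 0)"
      unfolding cnt_Suc[OF 1(1)] .
    moreover have "\<sigma>1 + pot (cnt p R k) \<le> base R + real (card (started p R k)) * l"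
      using Suc.IH[OF 1(1) True le(2)] .
    ultimately show ?thesis
      unfolding started_Suc[OF 1(1) True] by (auto simp: algebra_simps split: if_splits)
  next
    case False
    \<comment> \<open>The predecessor began before \<open>t0\<close>: nothing is counted yet, and it
      delays the present cycle beyond \<open>t0\<close> by less than its own execution time.\<close>
    have base: "base R = t0 + lmax / s"
      using False cyc_fst_le[OF 1(1)] by (simp add: base_def)
    have "\<not> t0 \<le> \<sigma>2" if "cyc p R i \<sigma>2 \<tau>2" "i < Suc k" for i \<sigma>2 \<tau>2
    proof (cases "i = k")
      case True
      then show ?thesis using that(1) 1(1) False cyc_unique by blast
    next
      case F: False
      with that have "i < k" by simp
      from cyc_less[OF 1(1) this] obtain \<sigma>3 \<tau>3 where "cyc p R i \<sigma>3 \<tau>3" "fin \<sigma>3 \<tau>3 \<le> \<sigma>1" by blast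
      then show ?thesis using False that(1) cyc_unique[OF that(1)] cyc_cost(3)[OF that(1)] by fastforce
    qed
    then have "started p R (Suc k) = {}" by (auto simp: started_def)
    moreover have "\<sigma> + pot (cnt p R (Suc k)) \<le> t0 + lmax / s"
    \<comment> \<open>After an lmin-task the counter may have any value up to \<open>g\<close>,
      which \<open>pot_cross\<close> absorbs; after an lmax-task it is 0.\<close>
    proof (cases "cost A \<tau>1 = lmin")
      case True
      then have "\<sigma> \<le> t0 + lmin / s" using \<sigma> False pos by auto
      then show ?thesis using pot_cross[OF cnt_le, of p R "Suc k"] by linarith
    next
      case F: False
      then have "cost A \<tau>1 = lmax" using cyc_cost(1)[OF 1(1)] by simp
      moreover have "0 < lmax / s" using lmax_pos s_gt1 by simp
      moreover have "pot (cnt p R (Suc k)) = 0" unfolding cnt_Suc[OF 1(1)] using F pot_0 by simp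
      ultimately show ?thesis using \<sigma> False by auto
    qed
    ultimately show ?thesis by (simp add: base)
  qed
qed

lemma finished_mono: "L \<le> L' \<Longrightarrow> finished p R L \<subseteq> finished p R L'"
  unfolding finished_def by (intro Collect_mono impI) (meson order_trans)

lemma finite_finished: "finite (finished p R L)"
proof (rule finite_subset[OF _ finite_arrived[of L]], rule subsetI)
  fix \<tau> assume "\<tau> \<in> finished p R L"
  then obtain k \<sigma> where "cyc p R k \<sigma> \<tau>" "fin \<sigma> \<tau> \<le> L" by (auto simp: finished_def)
  then show "\<tau> \<in> {\<tau> \<in> inj A. arr A \<tau> \<le> L}"
    using cyc_in_pend[of p R k \<sigma> \<tau>] cyc_cost(3)[of p R k \<sigma> \<tau>] by (simp add: pending_def)
qed

text \<open>The last cycle begun by time \<open>L\<close> ends after \<open>L\<close>.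
  \<open>start_bound\<close> limits its start, \<open>last_step\<close> its duration, and all
  counted cycles before it are finished by \<open>L\<close>. The \<open>+ 1\<close> pays for this
  cycle.\<close>

lemma run_bound:
  assumes p: "p \<in> {1..n}" "R \<in> runs A p" and L: "fst R \<le> L" "t0 \<le> L" "L \<le> t" "ereal L < snd R"
  shows "L < base R + (real (card (finished p R L)) + 1) * l"
proof -
  define K where "K = {k. \<exists>\<sigma> \<tau>. cyc p R k \<sigma> \<tau> \<and> \<sigma> \<le> L}"
  have "K \<subseteq> {..nat \<lceil>(L - fst R) / (lmin / s)\<rceil>}"
  proof
    fix k assume "k \<in> K"
    then obtain \<sigma> \<tau> where "cyc p R k \<sigma> \<tau>" "\<sigma> \<le> L" by (auto simp: K_def)
    with cyc_start_ge[of p R k \<sigma> \<tau>] have "real k * (lmin / s) \<le> L - fst R" by simp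
    moreover have "0 < lmin / s" using lmin_pos s_gt1 by simp
    ultimately have "real k \<le> (L - fst R) / (lmin / s)" by (simp only: pos_le_divide_eq)
    then show "k \<in> {..nat \<lceil>(L - fst R) / (lmin / s)\<rceil>}" by (simp add: le_nat_iff) linarith
  qed
  then have "finite K" by (rule finite_subset) simp
  have Lne: "pend L \<noteq> {}" using pend_ne L by simp
  obtain \<sigma>0 \<tau>0 where "cyc p R 0 \<sigma>0 \<tau>0" "\<sigma>0 \<le> L"
    using cyc_exists[OF p ready_0 L(1) L(4) Lne] by blast
  then have "K \<noteq> {}" by (auto simp: K_def)
  define k where "k = Max K"
  have "k \<in> K" using \<open>finite K\<close> \<open>K \<noteq> {}\<close> by (simp add: k_def)
  then obtain \<sigma> \<tau> where k: "cyc p R k \<sigma> \<tau>" "\<sigma> \<le> L" by (auto simp: K_def)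
  \<comment> \<open>Otherwise the processor would be ready with tasks pending, and a further cycle
    would have begun by \<open>L\<close>, against the maximality of \<open>k\<close>.\<close>
  have late: "L < fin \<sigma> \<tau>"
  proof (rule ccontr)
    assume "\<not> L < fin \<sigma> \<tau>"
    then have le: "fin \<sigma> \<tau> \<le> L" by simp
    then have "ereal (fin \<sigma> \<tau>) < snd R" using L(4) by (meson ereal_less_eq(3) order_le_less_trans)
    from cyc_exists[OF p ready_Suc[OF k(1) this] le L(4) Lne] obtain \<sigma>' \<tau>'
      where "cyc p R (Suc k) \<sigma>' \<tau>'" "\<sigma>' \<le> L" by blast
    then have "Suc k \<in> K" by (auto simp: K_def)
    then show False using Max_ge[OF \<open>finite K\<close>] k_def by fastforce
  qed
  show ?thesis
  proof (cases "t0 \<le> \<sigma>")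
    case True
    have \<sigma>t: "\<sigma> \<le> t" using k(2) L(3) by simp
    have *: "\<exists>\<sigma>1. cyc p R i \<sigma>1 (snd (the (X p R i))) \<and> t0 \<le> \<sigma>1 \<and> fin \<sigma>1 (snd (the (X p R i))) \<le> \<sigma>
        \<and> ereal (fin \<sigma>1 (snd (the (X p R i)))) < snd R \<and> cls (cost A (snd (the (X p R i))))"
      if i: "i \<in> started p R k" for i
    proof -
      from i obtain \<sigma>1 \<tau>1 where 1: "cyc p R i \<sigma>1 \<tau>1" "t0 \<le> \<sigma>1" "cls (cost A \<tau>1)" "i < k"
        by (auto simp: started_def)
      obtain \<sigma>2 \<tau>2 where 2: "cyc p R i \<sigma>2 \<tau>2" "ereal (fin \<sigma>2 \<tau>2) < snd R" "fin \<sigma>2 \<tau>2 \<le> \<sigma>"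
        using cyc_less[OF k(1) 1(4)] by blast
      then have "ereal (fin \<sigma>1 \<tau>1) < snd R" "fin \<sigma>1 \<tau>1 \<le> \<sigma>"
        using cyc_unique[OF 1(1) 2(1)] by simp_all
      with 1 show ?thesis by (auto simp: cyc_def)
    qed
    have "card (started p R k) \<le> card (finished p R L)"
    proof (rule card_inj_on_le[where f = "\<lambda>i. snd (the (X p R i))"])
      show "inj_on (\<lambda>i. snd (the (X p R i))) (started p R k)"
      proof (rule inj_onI)
        fix i j assume i: "i \<in> started p R k" and j: "j \<in> started p R k"
          and eq: "snd (the (X p R i)) = snd (the (X p R j))"
        from *[OF i] obtain \<sigma>1 where 1: "cyc p R i \<sigma>1 (snd (the (X p R i)))" "t0 \<le> \<sigma>1"
            "fin \<sigma>1 (snd (the (X p R i))) \<le> \<sigma>" "ereal (fin \<sigma>1 (snd (the (X p R i)))) < snd R"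
          by blast
        from *[OF j, folded eq] obtain \<sigma>2 where 2: "cyc p R j \<sigma>2 (snd (the (X p R i)))" "t0 \<le> \<sigma>2"
            "fin \<sigma>2 (snd (the (X p R i))) \<le> \<sigma>" "ereal (fin \<sigma>2 (snd (the (X p R i)))) < snd R"
          by blast
        show "i = j"
        proof (rule ccontr)
          assume "i \<noteq> j"
          then have "(R, i) \<noteq> (R, j)" by simp
          from cyc_disjoint[OF 1(1,4) 2(1,4) this]
          show False using cyc_not_reported[OF 1(1) 2(1) 1(4)] cyc_not_reported[OF 2(1) 1(1) 2(4)]
            by linarith
        qed
      qed
    next
      show "(\<lambda>i. snd (the (X p R i))) ` started p R k \<subseteq> finished p R L"
        using * k(2) unfolding finished_def by (fastforce intro: order_trans)
    qed (rule finite_finished)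
    then have "real (card (started p R k)) * l \<le> real (card (finished p R L)) * l"
      using l_pos by simp
    moreover have "cost A \<tau> / s \<le> pot (cnt p R k) + l"
      using last_step[OF _ cnt_le cyc_cost(1)[OF k(1)]] pick[OF k(1) busy[OF True \<sigma>t]] by blast
    ultimately show ?thesis
      using start_bound[OF k(1) True \<sigma>t] late by (simp add: algebra_simps)
  next
    case False
    \<comment> \<open>A last cycle begun before \<open>t0\<close> ends before
      \<open>t0 + lmax / s\<close>, which is already \<open>base R\<close>.\<close>
    then have "base R = t0 + lmax / s" using cyc_fst_le[OF k(1)] by (simp add: base_def)
    moreover have "cost A \<tau> / s \<le> lmax / s"
      using cyc_cost(4)[OF k(1)] s_gt1 by (simp add: divide_right_mono)
    moreover have "0 \<le> (real (card (finished p R L)) + 1) * l" using l_pos by simp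
    ultimately show ?thesis using late False by linarith
  qed
qed

section \<open>Comparison with an offline schedule\<close>

text \<open>The lead of the offline schedule in a run under way at \<open>t0\<close>: the delay
  \<open>lmax / s\<close> measured in units of \<open>l\<close>, and one execution that may have
  begun before \<open>t0\<close>.\<close>

abbreviation "extra \<equiv> 1 + nat \<lceil>lmax / (s * l)\<rceil>"

text \<open>Let \<open>L\<close> be the last offline completion in the run. Offline executions are
  disjoint and at least \<open>l\<close> long, so packing bounds their number in terms of
  \<open>L\<close>, while \<open>run_bound\<close> at the same \<open>L\<close> supplies finished
  tasks.\<close>

lemma run_match:
  assumes p: "p \<in> {1..n}" "R \<in> runs A p" and F: "finite F"
    and run: "\<And>x. x \<in> F \<Longrightarrow> fst R \<le> \<sigma> x \<and> ereal (\<sigma> x + cost A x) < snd R \<and>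
      t0 < \<sigma> x + cost A x \<and> \<sigma> x + cost A x \<le> t \<and> l \<le> cost A x"
    and disj: "\<And>x y. x \<in> F \<Longrightarrow> y \<in> F \<Longrightarrow> x \<noteq> y \<Longrightarrow>
      \<sigma> x + cost A x \<le> \<sigma> y \<or> \<sigma> y + cost A y \<le> \<sigma> x"
  shows "card F \<le> card (finished p R t) + (if t0 \<le> fst R then 0 else extra)"
proof (cases "F = {}")
  case False
  let ?f = "\<lambda>x. \<sigma> x + cost A x"
  define L where "L = Max (?f ` F)"
  have "L \<in> ?f ` F" using F False by (simp add: L_def)
  then obtain z where z: "z \<in> F" "L = ?f z" by blast
  have fL: "?f x \<le> L" if "x \<in> F" for x using that F by (simp add: L_def)
  have sep: "l \<le> \<bar>?f x - ?f y\<bar>" if "x \<in> F" "y \<in> F" "x \<noteq> y" for x y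
    using disj[OF that] run[OF that(1)] run[OF that(2)] by auto
  \<comment> \<open>In a run begun at or after \<open>t0\<close> the first completion comes at least
    \<open>l\<close> after the restart; in an older run it is only known to come after
    \<open>t0\<close>.\<close>
  have lb: "(if t0 \<le> fst R then fst R + l else t0) \<le> ?f x" if "x \<in> F" for x
    using run[OF that] by auto
  have pack: "(real (card F) - 1) * l \<le> L - (if t0 \<le> fst R then fst R + l else t0)"
    using card_separated_le[OF F False, of l _ ?f L] l_pos lb fL sep by auto
  have "L < base R + (real (card (finished p R L)) + 1) * l"
    using run[OF z(1)] z(2) l_pos by (intro run_bound[OF p]) auto
  moreover have "real (card (finished p R L)) \<le> real (card (finished p R t))"
    using card_mono[OF finite_finished finished_mono, of L t] run[OF z(1)] z(2) by simp
  then have "(real (card (finished p R L)) + 1) * l \<le> (real (card (finished p R t)) + 1) * l"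
    using l_pos by simp
  ultimately have L: "L < base R + (real (card (finished p R t)) + 1) * l" by linarith
  show ?thesis
  proof (cases "t0 \<le> fst R")
    case True
    \<comment> \<open>The strictness of \<open>run_bound\<close> is essential:
      \<open>card F - 1 < m\<close> for integers yields \<open>card F \<le> m\<close> without
      loss.\<close>
    with pack L have "(real (card F) - 1) * l < real (card (finished p R t)) * l"
      by (simp add: base_def algebra_simps)
    then have "real (card F) - 1 < real (card (finished p R t))" using l_pos by simp
    then show ?thesis using True by simp
  next
    case F: False
    with pack L have "(real (card F) - 1) * l < lmax / s + (real (card (finished p R t)) + 1) * l"
      by (simp add: base_def)
    also have "lmax / s = lmax / (s * l) * l" using l_pos by simp
    finally have "(real (card F) - 1) * l < (lmax / (s * l) + (real (card (finished p R t)) + 1)) * l"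
      by (simp only: distrib_right)
    then have "real (card F) - 1 < lmax / (s * l) + (real (card (finished p R t)) + 1)"
      using l_pos by simp
    moreover have "lmax / (s * l) \<le> real (nat \<lceil>lmax / (s * l)\<rceil>)" by linarith
    ultimately have "real (card F) < real (card (finished p R t) + extra + 1)" by simp
    then show ?thesis using F by simp
  qed
qed simp

definition all_finished :: "nat set" where
  "all_finished = (\<Union>p\<in>{1..n}. \<Union>R\<in>runs A p. finished p R t)"

text \<open>Throughout the phase the queue is long, so both picks are \<open>good\<close> and cannot
  complete the same task in different cycles.\<close>

lemma finished_disjoint:
  assumes "\<tau> \<in> finished p R t" "\<tau> \<in> finished p' R' t"
  shows "p = p' \<and> R = R'"
proof -
  from assms obtain k \<sigma> k' \<sigma>' where
    1: "cyc p R k \<sigma> \<tau>" "t0 \<le> \<sigma>" "fin \<sigma> \<tau> \<le> t" "ereal (fin \<sigma> \<tau>) < snd R" and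
    2: "cyc p' R' k' \<sigma>' \<tau>" "t0 \<le> \<sigma>'" "fin \<sigma>' \<tau> \<le> t" "ereal (fin \<sigma>' \<tau>) < snd R'"
    by (auto simp: finished_def)
  have "good p \<sigma> \<tau>" using pick[OF 1(1) busy] 1 cyc_cost(3)[OF 1(1)] by auto
  moreover have "good p' \<sigma>' \<tau>" using pick[OF 2(1) busy] 2 cyc_cost(3)[OF 2(1)] by auto
  ultimately show ?thesis using good_disjoint[OF 1(1,4) _ 2(1,4)] by blast
qed

lemma all_finishedD:
  assumes "\<tau> \<in> all_finished"
  shows "\<tau> \<in> inj A" "arr A \<tau> \<le> t" "cls (cost A \<tau>)" "\<tau> \<notin> pend t"
    "arr A \<tau> \<le> t0 \<Longrightarrow> \<tau> \<in> pend t0"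
proof -
  from assms obtain p R k \<sigma> where
    1: "cyc p R k \<sigma> \<tau>" "t0 \<le> \<sigma>" "fin \<sigma> \<tau> \<le> t" "ereal (fin \<sigma> \<tau>) < snd R" "cls (cost A \<tau>)"
    by (auto simp: all_finished_def finished_def)
  have p: "\<tau> \<in> pend \<sigma>" using cyc_in_pend[OF 1(1)] .
  show "cls (cost A \<tau>)" by fact
  show "\<tau> \<in> inj A" using p by (simp add: pending_def)
  show "arr A \<tau> \<le> t" using p 1 cyc_cost(3)[OF 1(1)] by (simp add: pending_def)
  have "(\<tau>, fin \<sigma> \<tau>) \<in> Rep" unfolding reports_iff using 1 by blast
  then show "\<tau> \<notin> pend t" using 1(3) by (auto simp: pending_def)
  show "\<tau> \<in> pend t0" if "arr A \<tau> \<le> t0" using p that 1(2) by (auto simp: pending_def)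
qed

text \<open>Each task is charged to a processor and a run in which the schedule completes it. By
  \<open>run_match\<close> a run falls behind by at most \<open>extra\<close>, and only if it began
  before \<open>t0\<close>; at most one such run per processor is charged. As the sets of finished
  tasks of distinct runs are disjoint, the bounds add up.\<close>

lemma phase_compare:
  assumes S: "valid_offline n A S"
    and T: "\<And>\<tau>. \<tau> \<in> T \<Longrightarrow> cls (cost A \<tau>) \<and>
      (\<exists>p \<sigma>. (p, \<sigma>, \<tau>) \<in> S \<and> t0 < \<sigma> + cost A \<tau> \<and> \<sigma> + cost A \<tau> \<le> t)"
  shows "card T \<le> card all_finished + n * extra"
proof -
  have Sruns: "p \<in> {1..n} \<and> \<tau> \<in> inj A \<and> arr A \<tau> \<le> \<sigma> \<and>
      (\<exists>R\<in>runs A p. fst R \<le> \<sigma> \<and> ereal (\<sigma> + cost A \<tau>) < snd R)" if "(p, \<sigma>, \<tau>) \<in> S" for p \<sigma> \<tau>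
    using bspec[OF conjunct1[OF S[unfolded valid_offline_def]] that]
    by (simp add: case_prod_beta)
  have Sdisj: "\<sigma> + cost A \<tau> \<le> \<sigma>' \<or> \<sigma>' + cost A \<tau>' \<le> \<sigma>"
    if "(p, \<sigma>, \<tau>) \<in> S" "(p, \<sigma>', \<tau>') \<in> S" "(\<sigma>, \<tau>) \<noteq> (\<sigma>', \<tau>')" for p \<sigma> \<tau> \<sigma>' \<tau>'
    using bspec[OF bspec[OF conjunct2[OF S[unfolded valid_offline_def]] that(1),
      unfolded case_prod_beta] that(2)] that(3)
    by simp
  define \<Phi> where "\<Phi> p R \<sigma> \<tau> \<longleftrightarrow> (p, \<sigma>, \<tau>) \<in> S \<and> t0 < \<sigma> + cost A \<tau> \<and> \<sigma> + cost A \<tau> \<le> t \<and>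
      R \<in> runs A p \<and> fst R \<le> \<sigma> \<and> ereal (\<sigma> + cost A \<tau>) < snd R" for p R \<sigma> \<tau>
  have "\<exists>q. \<Phi> (fst q) (fst (snd q)) (snd (snd q)) \<tau>" if "\<tau> \<in> T" for \<tau>
  proof -
    from T[OF that] obtain p \<sigma> where "(p, \<sigma>, \<tau>) \<in> S" "t0 < \<sigma> + cost A \<tau>" "\<sigma> + cost A \<tau> \<le> t"
      by blast
    moreover from Sruns[OF this(1)] obtain R where
      "R \<in> runs A p" "fst R \<le> \<sigma>" "ereal (\<sigma> + cost A \<tau>) < snd R" by blast
    ultimately show ?thesis by (intro exI[of _ "(p, R, \<sigma>)"]) (simp add: \<Phi>_def)
  qed
  \<comment> \<open>The schedule may execute a task more than once; \<open>q\<close> selects one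
    processor, run and start time for it.\<close>
  then obtain q where q: "\<And>\<tau>. \<tau> \<in> T \<Longrightarrow> \<Phi> (fst (q \<tau>)) (fst (snd (q \<tau>))) (snd (snd (q \<tau>))) \<tau>"
    by metis
  define P where "P \<tau> = (fst (q \<tau>), fst (snd (q \<tau>)))" for \<tau>
  define \<sigma> where "\<sigma> \<tau> = snd (snd (q \<tau>))" for \<tau>
  have q': "(fst (P \<tau>), \<sigma> \<tau>, \<tau>) \<in> S" "t0 < \<sigma> \<tau> + cost A \<tau>" "\<sigma> \<tau> + cost A \<tau> \<le> t"
    "snd (P \<tau>) \<in> runs A (fst (P \<tau>))" "fst (snd (P \<tau>)) \<le> \<sigma> \<tau>"
    "ereal (\<sigma> \<tau> + cost A \<tau>) < snd (snd (P \<tau>))" if "\<tau> \<in> T" for \<tau>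
    using q[OF that] by (simp_all add: P_def \<sigma>_def \<Phi>_def)
  have costT: "cost A \<tau> = lmin \<or> cost A \<tau> = lmax" if "\<tau> \<in> T" for \<tau>
    using Sruns[OF q'(1)[OF that]] cost_cases by blast
  have "finite T"
  proof (rule finite_subset[OF _ finite_arrived[of t]], rule subsetI)
    fix \<tau> assume \<tau>: "\<tau> \<in> T"
    have "0 < cost A \<tau>" using costT[OF \<tau>] lmin_pos lmax_pos by auto
    then show "\<tau> \<in> {\<tau> \<in> inj A. arr A \<tau> \<le> t}"
      using Sruns[OF q'(1)[OF \<tau>]] q'(3)[OF \<tau>] by auto
  qed
  have PT: "fst x \<in> {1..n} \<and> snd x \<in> runs A (fst x)" if "x \<in> P ` T" for x
    using that Sruns[OF q'(1)] q'(4) by auto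
  define C where "C = {x \<in> P ` T. \<not> t0 \<le> fst (snd x)}"
  have "finite (P ` T)" using \<open>finite T\<close> by simp
  then have "finite C" by (simp add: C_def)
  \<comment> \<open>Runs in \<open>C\<close> began before \<open>t0\<close> and end after it, so two
    of them on one processor would overlap.\<close>
  have "inj_on fst C"
  proof (rule inj_onI, rule ccontr)
    fix x y assume x: "x \<in> C" and y: "y \<in> C" and xy: "fst x = fst y" "x \<noteq> y"
    obtain \<tau> \<tau>' where \<tau>: "\<tau> \<in> T" "x = P \<tau>" and \<tau>': "\<tau>' \<in> T" "y = P \<tau>'"
      using x y by (auto simp: C_def)
    have "ereal t0 < snd (snd x)" "ereal t0 < snd (snd y)"
      using q'(2,6)[OF \<tau>(1)] q'(2,6)[OF \<tau>'(1)] \<tau>(2) \<tau>'(2)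
        order_less_trans[OF less_ereal.simps(1)[THEN iffD2]] by blast+
    moreover have "snd x \<noteq> snd y" using xy by (simp add: prod_eq_iff)
    moreover have "snd x \<in> runs A (fst x)" "snd y \<in> runs A (fst x)"
      using PT[of x] PT[of y] x y xy by (simp_all add: C_def)
    ultimately have "ereal t0 < ereal (fst (snd y)) \<or> ereal t0 < ereal (fst (snd x))"
      using runs_disjoint[of "snd x" "fst x" "snd y"] order_less_le_trans by blast
    then show False using x y by (auto simp: C_def)
  qed
  moreover have "fst ` C \<subseteq> {1..n}" using PT unfolding C_def by blast
  ultimately have "card C \<le> n" using card_inj_on_le[of fst C "{1..n}"] by simp
  have fib: "card {\<tau> \<in> T. P \<tau> = x}
      \<le> card (finished (fst x) (snd x) t) + (if x \<in> C then extra else 0)" if x: "x \<in> P ` T" for x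
  proof -
    have "card {\<tau> \<in> T. P \<tau> = x} \<le> card (finished (fst x) (snd x) t)
        + (if t0 \<le> fst (snd x) then 0 else extra)"
    proof (rule run_match[where \<sigma> = \<sigma>])
      show "finite {\<tau> \<in> T. P \<tau> = x}" using \<open>finite T\<close> by simp
    next
      fix \<tau> assume "\<tau> \<in> {\<tau> \<in> T. P \<tau> = x}"
      then show "fst (snd x) \<le> \<sigma> \<tau> \<and> ereal (\<sigma> \<tau> + cost A \<tau>) < snd (snd x) \<and>
          t0 < \<sigma> \<tau> + cost A \<tau> \<and> \<sigma> \<tau> + cost A \<tau> \<le> t \<and> l \<le> cost A \<tau>"
        using q' l_le T costT by auto
    next
      fix \<tau> \<tau>' assume "\<tau> \<in> {\<tau> \<in> T. P \<tau> = x}" "\<tau>' \<in> {\<tau> \<in> T. P \<tau> = x}" "\<tau> \<noteq> \<tau>'"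
      then show "\<sigma> \<tau> + cost A \<tau> \<le> \<sigma> \<tau>' \<or> \<sigma> \<tau>' + cost A \<tau>' \<le> \<sigma> \<tau>"
        using Sdisj[of "fst x" "\<sigma> \<tau>" \<tau> "\<sigma> \<tau>'" \<tau>'] q'(1)[of \<tau>] q'(1)[of \<tau>'] by auto
    qed (use PT[OF x] in auto)
    then show ?thesis using x by (auto simp: C_def split: if_splits)
  qed
  have disj: "finished (fst x) (snd x) t \<inter> finished (fst y) (snd y) t = {}" if "x \<noteq> y" for x y
    using finished_disjoint[of _ "fst x" "snd x" "fst y" "snd y"] that prod_eqI by blast
  have "finite all_finished"
    by (rule finite_subset[OF _ finite_arrived[of t]]) (auto dest: all_finishedD)
  have "card T = (\<Sum>x\<in>P ` T. card {\<tau> \<in> T. P \<tau> = x})"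
    using sum.image_gen[OF \<open>finite T\<close>, of "\<lambda>_. 1 :: nat" P] by simp
  also have "\<dots> \<le> (\<Sum>x\<in>P ` T. card (finished (fst x) (snd x) t) + (if x \<in> C then extra else 0))"
    by (rule sum_mono) (rule fib)
  also have "\<dots> = (\<Sum>x\<in>P ` T. card (finished (fst x) (snd x) t))
      + (\<Sum>x\<in>P ` T. if x \<in> C then extra else 0)"
    by (rule sum.distrib)
  also have "(\<Sum>x\<in>P ` T. if x \<in> C then extra else 0) = card C * extra"
  proof -
    have "P ` T \<inter> C = C" by (auto simp: C_def)
    then show ?thesis using sum.inter_restrict[OF \<open>finite (P ` T)\<close>, of "\<lambda>_. extra" C] by simp
  qed
  also have "(\<Sum>x\<in>P ` T. card (finished (fst x) (snd x) t))
      = card (\<Union>x\<in>P ` T. finished (fst x) (snd x) t)"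
    by (intro card_UN_disjoint[symmetric] ballI impI finite_finished disj \<open>finite (P ` T)\<close>)
  also have "\<dots> \<le> card all_finished"
    using PT unfolding all_finished_def[symmetric]
    by (intro card_mono \<open>finite all_finished\<close> UN_least) (unfold all_finished_def, blast)
  also have "card C * extra \<le> n * extra" using \<open>card C \<le> n\<close> by (rule mult_le_mono1)
  finally show ?thesis by simp
qed

end

section \<open>Potentials for the two queues\<close>

context burst
begin

text \<open>The first two estimates are the two halves of the ceiling in \<open>gamma\<close>:
  sufficiency, which rearranges \<open>(g * lmin + lmax) / s \<le> (g + 1) * lmin\<close>, and
  minimality. The third rearranges the lower bound on the speedup.\<close>

lemma gamma_bounds:
  "lmax - s * lmin \<le> real g * ((s - 1) * lmin)"
  "real g * ((s - 1) * lmin) < lmax - lmin"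
  "real g * lmin + lmax \<le> s * lmax"
proof -
  define d where "d = (s - 1) * lmin"
  have d: "0 < d" using s_gt1 lmin_pos by (simp add: d_def)
  have "0 < lmax - s * lmin" using s_less lmin_pos by (simp add: field_simps)
  then have "0 < (lmax - s * lmin) / d" using d by simp
  then have "real g = of_int \<lceil>(lmax - s * lmin) / d\<rceil>"
    by (simp add: gamma_def d_def[symmetric])
  then have "(lmax - s * lmin) / d \<le> real g" "real g < (lmax - s * lmin) / d + 1"
    by linarith+
  then have "lmax - s * lmin \<le> real g * d" "real g * d < lmax - s * lmin + d"
    using d by (simp_all add: field_simps)
  then show "lmax - s * lmin \<le> real g * ((s - 1) * lmin)"
    "real g * ((s - 1) * lmin) < lmax - lmin"
    by (simp_all add: d_def algebra_simps)
  show "real g * lmin + lmax \<le> s * lmax"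
    using s_ge lmax_pos by (simp add: field_simps)
qed

text \<open>Tasks of both costs count, each worth \<open>lmin\<close> of time. An lmin-task takes
  only \<open>lmin / s\<close>, and the potential stores the saving \<open>lmin - lmin / s\<close>;
  \<open>g\<close> savings cover the excess \<open>lmax / s - lmin\<close> of the next
  lmax-task.\<close>

lemma phase_min:
  assumes "t0 \<le> t" "\<And>w. t0 \<le> w \<Longrightarrow> w \<le> t \<Longrightarrow> n^2 \<le> card (pendc lmin w)"
  shows "phase n s lmin lmax A X t0 t lmin lmin (\<lambda>k. real k * (lmin * (1 - 1 / s))) (\<lambda>_. True)
    (\<lambda>k w. w = lmin \<or> w = lmax \<and> k = g)"
proof -
  have s: "0 < s" "0 \<le> 1 - 1 / s" using s_gt1 by simp_all
  have scale: "real g * (lmin * (1 - 1 / s)) = real g * ((s - 1) * lmin) / s"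
    using s by (simp add: field_simps)
  have "(lmax - s * lmin) / s \<le> real g * ((s - 1) * lmin) / s"
    using gamma_bounds(1) s by (intro divide_right_mono) auto
  then have ge: "lmax / s - lmin \<le> real g * (lmin * (1 - 1 / s))"
    unfolding scale using s by (simp add: diff_divide_distrib)
  \<comment> \<open>Minimality of \<open>g\<close> limits the largest potential, as
    \<open>pot_cross\<close> requires.\<close>
  have "real g * ((s - 1) * lmin) / s \<le> (lmax - lmin) / s"
    using gamma_bounds(2) s by (intro divide_right_mono) auto
  then have le: "lmin / s + real g * (lmin * (1 - 1 / s)) \<le> lmax / s"
    unfolding scale by (simp add: diff_divide_distrib)
  have nn: "0 \<le> lmin * (1 - 1 / s)" using s lmin_pos by simp
  have eq: "lmin * (1 - 1 / s) = lmin - lmin / s" by (simp add: algebra_simps)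
  show ?thesis
  proof (unfold_locales, goal_cases)
    case 1
    then show ?case by (rule assms(1))
  next
    case (2 w)
    then show ?case by (rule assms(2))
  next
    case (3 p R k \<sigma> \<tau>)
    then show ?case by (rule pick_min)
  next
    case (4 k w)
    show ?case
    proof (cases "w = lmin")
      case True
      have "real (min (k + 1) g) * (lmin * (1 - 1 / s)) \<le> (real k + 1) * (lmin * (1 - 1 / s))"
        using nn by (intro mult_right_mono) auto
      with True eq show ?thesis by (simp add: algebra_simps)
    next
      case False
      with 4 ge show ?thesis by simp
    qed
  next
    case (5 k w)
    show ?case
    proof (cases "w = lmin")
      case True
      have "lmin / s \<le> lmin" using s_gt1 lmin_pos by (simp add: field_simps)
      moreover have "0 \<le> real k * (lmin * (1 - 1 / s))" using nn by simp
      ultimately show ?thesis unfolding True by linarith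
    next
      case False
      with 5 ge show ?thesis by simp
    qed
  next
    case (7 k)
    have "real k * (lmin * (1 - 1 / s)) \<le> real g * (lmin * (1 - 1 / s))"
      using nn 7 by (intro mult_right_mono) auto
    with le show ?case by linarith
  qed (use lmin_pos lmin_lmax in auto)
qed

text \<open>Only lmax-tasks count, so time spent on lmin-tasks is a debt, whence the negative sign.
  At most \<open>g\<close> lmin-tasks precede an lmax-task, and by the third estimate of
  \<open>gamma_bounds\<close> the whole burst takes at most \<open>lmax\<close>.\<close>

lemma phase_max:
  assumes "t0 \<le> t" "\<And>w. t0 \<le> w \<Longrightarrow> w \<le> t \<Longrightarrow> n^2 \<le> card (pendc lmax w)"
  shows "phase n s lmin lmax A X t0 t lmax lmax (\<lambda>k. - (real k * (lmin / s))) (\<lambda>w. w = lmax)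
    (\<lambda>k w. w = lmax \<or> w = lmin \<and> k < g)"
proof -
  have s: "0 < s" using s_gt1 by simp
  have nn: "0 \<le> lmin / s" using s lmin_pos by simp
  have ge: "real g * (lmin / s) + lmax / s \<le> lmax"
    using gamma_bounds(3) s by (simp add: field_simps)
  have mono: "real k * (lmin / s) \<le> real g * (lmin / s)" if "k \<le> g" for k
    using nn that by (intro mult_right_mono) auto
  show ?thesis
  proof (unfold_locales, goal_cases)
    case 1
    then show ?case by (rule assms(1))
  next
    case (2 w)
    then show ?case by (rule assms(2))
  next
    case (3 p R k \<sigma> \<tau>)
    then show ?case by (rule pick_max)
  next
    case (4 k w)
    show ?case
    proof (cases "w = lmin")
      case True
      with 4 lmin_lmax have "min (k + 1) g = k + 1" by auto
      with True lmin_lmax show ?thesis by (simp add: algebra_simps add_divide_distrib)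
    next
      case False
      with 4 ge mono[of k] show ?thesis by auto
    qed
  next
    case (5 k w)
    have "w / s \<le> lmax / s" using 5 lmin_lmax s by (auto simp: divide_right_mono)
    with ge mono[OF 5(2)] show ?case by linarith
  next
    case (7 k)
    have "0 \<le> real k * (lmin / s)" using nn by (intro mult_nonneg_nonneg) simp_all
    moreover have "lmin / s \<le> lmax / s" using lmin_lmax s by (simp add: divide_right_mono)
    ultimately show ?case by linarith
  qed (use lmax_pos in auto)
qed

section \<open>The last time at which a queue was short\<close>

text \<open>A queue grows only at arrivals, so \<open>t0\<close> is sought among the finitely many
  arrival times. Tasks arriving at \<open>t0\<close> itself are left out of the final count, because
  they may be what makes the queue long.\<close>

lemma last_low:
  assumes "n^2 \<le> card (pendc c t)"
  obtains t0 where "t0 \<le> t" "\<And>w. t0 \<le> w \<Longrightarrow> w \<le> t \<Longrightarrow> n^2 \<le> card (pendc c w)"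
    "card {\<tau> \<in> pendc c t0. arr A \<tau> < t0} < n^2"
proof -
  define Arr where "Arr = arr A ` {\<tau> \<in> inj A. arr A \<tau> \<le> t}"
  have "finite Arr" using finite_arrived by (simp add: Arr_def)
  have arrE: "arr A \<tau> \<in> Arr" if "\<tau> \<in> pendc c w" "w \<le> t" for \<tau> w
    using that by (auto simp: Arr_def pendc_def pending_def)
  define low where "low v \<longleftrightarrow> card {\<tau> \<in> pendc c v. arr A \<tau> < v} < n^2" for v
  have n2: "0 < n^2" using n_pos by simp
  \<comment> \<open>Take the first arrival time \<open>v\<close> after \<open>w\<close>, which
    exists because the queue is long again at \<open>t\<close>. Up to \<open>v\<close> tasks only
    leave, so those older than \<open>v\<close> are still few.\<close>
  have next_low: "\<exists>v\<in>Arr. w < v \<and> low v" if "w \<le> t" "card (pendc c w) < n^2" for w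
  proof -
    let ?B = "{v \<in> Arr. w < v}"
    have "pendc c t \<subseteq> pendc c w" if "?B = {}"
      using that arrE \<open>w \<le> t\<close> by (fastforce simp: pendc_def pending_def)
    then have "?B \<noteq> {}"
      using that(2) assms card_mono[OF finite_pendc, of "pendc c t" c w] by fastforce
    define v where "v = Min ?B"
    have v: "v \<in> ?B" "\<And>u. u \<in> ?B \<Longrightarrow> v \<le> u"
      using \<open>finite Arr\<close> \<open>?B \<noteq> {}\<close> Min_in[of ?B] by (simp_all add: v_def)
    have "v \<le> t" using v(1) by (auto simp: Arr_def)
    have "{\<tau> \<in> pendc c v. arr A \<tau> < v} \<subseteq> pendc c w"
    proof
      fix \<tau> assume \<tau>: "\<tau> \<in> {\<tau> \<in> pendc c v. arr A \<tau> < v}"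
      then have "arr A \<tau> \<in> Arr" using arrE \<open>v \<le> t\<close> by blast
      then have "\<not> w < arr A \<tau>" using v(2)[of "arr A \<tau>"] \<tau> by auto
      then show "\<tau> \<in> pendc c w" using \<tau> v(1) by (auto simp: pendc_def pending_def)
    qed
    then have "card {\<tau> \<in> pendc c v. arr A \<tau> < v} \<le> card (pendc c w)"
      by (intro card_mono finite_pendc)
    with that(2) have "low v" unfolding low_def by linarith
    with v(1) show ?thesis by blast
  qed
  have "pendc c t \<noteq> {}" using assms n2 by auto
  then have "Arr \<noteq> {}" using arrE by blast
  \<comment> \<open>At the earliest arrival time there is no older task, so at least one low time
    exists.\<close>
  have none: "{\<tau> \<in> pendc c (Min Arr). arr A \<tau> < Min Arr} = {}"
  proof -
    have "Min Arr \<le> t" using Min_in[OF \<open>finite Arr\<close> \<open>Arr \<noteq> {}\<close>] by (auto simp: Arr_def)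
    then have "Min Arr \<le> arr A \<tau>" if "\<tau> \<in> pendc c (Min Arr)" for \<tau>
      using arrE[OF that] \<open>finite Arr\<close> by simp
    then show ?thesis by fastforce
  qed
  then have "low (Min Arr)" using n2 unfolding low_def none by simp
  define t0 where "t0 = Max {v \<in> Arr. low v}"
  have ne: "{v \<in> Arr. low v} \<noteq> {}"
    using \<open>low (Min Arr)\<close> Min_in[OF \<open>finite Arr\<close> \<open>Arr \<noteq> {}\<close>] by blast
  have t0: "t0 \<in> Arr" "low t0" "\<And>v. v \<in> Arr \<Longrightarrow> low v \<Longrightarrow> v \<le> t0"
    using Max_in[OF _ ne] \<open>finite Arr\<close> by (simp_all add: t0_def)
  show thesis
  proof (rule that)
    show "t0 \<le> t" using t0(1) by (auto simp: Arr_def)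
    show "card {\<tau> \<in> pendc c t0. arr A \<tau> < t0} < n^2" using t0(2) by (simp add: low_def)
    show "n^2 \<le> card (pendc c w)" if w: "t0 \<le> w" "w \<le> t" for w
    proof (rule ccontr)
      assume "\<not> n^2 \<le> card (pendc c w)"
      then obtain v where "v \<in> Arr" "w < v" "low v" using next_low[OF w(2)] by auto
      then show False using t0(3) w(1) by fastforce
    qed
  qed
qed

section \<open>Bounds on the numbers of tasks and on pending cost\<close>

abbreviation "opend S \<equiv> pending A (offline_reports A S)"

text \<open>A task not reported by \<open>t0\<close> is completed later; one arriving at or after
  \<open>t0\<close> still needs its positive cost, so its completion is strictly later than
  \<open>t0\<close> as well.\<close>

lemma offline_reported:
  assumes S: "valid_offline n A S" and "\<tau> \<in> inj A" "arr A \<tau> \<le> t" "\<tau> \<notin> opend S t"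
    and "\<tau> \<in> opend S t0 \<or> t0 \<le> arr A \<tau>"
  shows "\<exists>p \<sigma>. (p, \<sigma>, \<tau>) \<in> S \<and> t0 < \<sigma> + cost A \<tau> \<and> \<sigma> + cost A \<tau> \<le> t"
proof -
  obtain p \<sigma> where 1: "(p, \<sigma>, \<tau>) \<in> S" "\<sigma> + cost A \<tau> \<le> t"
    using assms(2-4) by (auto simp: pending_def offline_reports_def)
  have "0 < cost A \<tau>" using cost_cases[OF assms(2)] lmin_pos lmax_pos by auto
  moreover have "arr A \<tau> \<le> \<sigma>" using S 1(1) by (auto simp: valid_offline_def)
  moreover have "(\<tau>, \<sigma> + cost A \<tau>) \<in> offline_reports A S"
    using 1(1) by (auto simp: offline_reports_def)
  ultimately have "t0 < \<sigma> + cost A \<tau>"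
    using assms(5) by (force simp: pending_def not_le)
  with 1 show ?thesis by blast
qed

text \<open>For \<open>t0\<close> from \<open>last_low\<close>, pending and finished lmax-tasks are
  either among fewer than \<open>n^2\<close> old ones or newly arrived. New ones that the schedule
  has completed are matched by \<open>phase_compare\<close>.\<close>

lemma max_bound:
  assumes S: "valid_offline n A S"
  shows "card (pendc lmax t) \<le> card {\<tau> \<in> opend S t. cost A \<tau> = lmax} + n^2 + 2 * n"
proof (cases "n^2 \<le> card (pendc lmax t)")
  case True
  then obtain t0 where t0: "t0 \<le> t" "\<And>w. t0 \<le> w \<Longrightarrow> w \<le> t \<Longrightarrow> n^2 \<le> card (pendc lmax w)"
    "card {\<tau> \<in> pendc lmax t0. arr A \<tau> < t0} < n^2" by (rule last_low) blast
  interpret phase n s lmin lmax A X t0 t lmax lmax "\<lambda>k. - (real k * (lmin / s))" "\<lambda>w. w = lmax"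
    "\<lambda>k w. w = lmax \<or> w = lmin \<and> k < g"
    by (rule phase_max[OF t0(1,2)])
  define Q where "Q = {\<tau> \<in> pendc lmax t0. arr A \<tau> < t0}"
  define New where "New = {\<tau> \<in> inj A. cost A \<tau> = lmax \<and> t0 \<le> arr A \<tau> \<and> arr A \<tau> \<le> t}"
  define PO where "PO = {\<tau> \<in> opend S t. cost A \<tau> = lmax}"
  have fin: "finite Q" "finite New" "finite PO"
    using finite_pendc finite_pending
    by (auto simp: Q_def New_def PO_def intro: finite_subset[OF _ finite_arrived[of t]])
  have "pendc lmax t \<union> all_finished \<subseteq> Q \<union> New"
    using t0(1) all_finishedD by (fastforce simp: Q_def New_def pendc_def pending_def)
  moreover have "pendc lmax t \<inter> all_finished = {}"
    using all_finishedD(4) by (auto simp: pendc_def)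
  ultimately have "card (pendc lmax t) + card all_finished \<le> card (Q \<union> New)"
    using card_mono[of "Q \<union> New" "pendc lmax t \<union> all_finished"] fin finite_pendc
    by (metis card_Un_disjoint finite_UnI finite_subset sup.bounded_iff)
  also have "\<dots> \<le> card Q + card New" by (rule card_Un_le)
  finally have 1: "card (pendc lmax t) + card all_finished \<le> card Q + card New" .
  have "card New \<le> card (PO \<union> (New - PO))" using fin by (intro card_mono) auto
  also have "\<dots> \<le> card PO + card (New - PO)" by (rule card_Un_le)
  also have "card (New - PO) \<le> card all_finished + n * extra"
  proof (rule phase_compare[OF S])
    fix \<tau> assume "\<tau> \<in> New - PO"
    then show "cost A \<tau> = lmax \<and> (\<exists>p \<sigma>. (p, \<sigma>, \<tau>) \<in> S \<and> t0 < \<sigma> + cost A \<tau> \<and> \<sigma> + cost A \<tau> \<le> t)"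
      by (intro conjI offline_reported[OF S]) (auto simp: New_def PO_def)
  qed
  \<comment> \<open>The quotient is \<open>1 / s\<close>, strictly between 0 and 1, so
    \<open>extra\<close> is 2 here.\<close>
  also have "\<lceil>lmax / (s * lmax)\<rceil> = 1"
    using s_gt1 lmax_pos by (simp add: ceiling_eq_iff)
  finally show ?thesis using 1 t0(3) unfolding Q_def[symmetric] PO_def[symmetric] by simp
qed auto

text \<open>At \<open>t0\<close> the lmin-queue is short, but the lmax-queue need not be.
  \<open>max_bound\<close> at \<open>t0\<close> replaces it by the offline lmax-tasks
  \<open>MO\<close>, which then enter the comparison together with the new arrivals.\<close>

lemma count_bound:
  assumes S: "valid_offline n A S" and min: "n^2 \<le> card (pendc lmin t)"
  shows "card (pend t) \<le> card (opend S t) + 2 * n^2 + 2 * n + n * (1 + nat \<lceil>lmax / (s * lmin)\<rceil>)"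
proof -
  obtain t0 where t0: "t0 \<le> t" "\<And>w. t0 \<le> w \<Longrightarrow> w \<le> t \<Longrightarrow> n^2 \<le> card (pendc lmin w)"
    "card {\<tau> \<in> pendc lmin t0. arr A \<tau> < t0} < n^2" using min by (rule last_low) blast
  interpret phase n s lmin lmax A X t0 t lmin lmin "\<lambda>k. real k * (lmin * (1 - 1 / s))" "\<lambda>_. True"
    "\<lambda>k w. w = lmin \<or> w = lmax \<and> k = g"
    by (rule phase_min[OF t0(1,2)])
  define Q where "Q = {\<tau> \<in> pendc lmin t0. arr A \<tau> < t0}"
  define M where "M = pendc lmax t0"
  \<comment> \<open>Arrivals exactly at \<open>t0\<close>: those of cost lmin belong to
    \<open>New1\<close>, since \<open>Q\<close> holds only older tasks; those of cost lmax are left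
    to \<open>M\<close> and \<open>MO\<close>, so \<open>New2\<close> starts strictly later.\<close>
  define New1 where "New1 = {\<tau> \<in> inj A. cost A \<tau> = lmin \<and> t0 \<le> arr A \<tau> \<and> arr A \<tau> \<le> t}"
  define New2 where "New2 = {\<tau> \<in> inj A. cost A \<tau> = lmax \<and> t0 < arr A \<tau> \<and> arr A \<tau> \<le> t}"
  define MO where "MO = {\<tau> \<in> opend S t0. cost A \<tau> = lmax}"
  define T where "T = (New1 \<union> New2 \<union> MO) - opend S t"
  have fin: "finite Q" "finite M" "finite New1" "finite New2" "finite MO"
    using finite_pendc finite_pending
    by (auto simp: Q_def M_def New1_def New2_def MO_def intro: finite_subset[OF _ finite_arrived[of t]])
  let ?U = "Q \<union> M \<union> (New1 \<union> New2)"
  have "pend t \<subseteq> ?U"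
  proof
    fix \<tau> assume "\<tau> \<in> pend t"
    then show "\<tau> \<in> ?U"
      using t0(1) cost_cases[of \<tau>]
      by (cases "arr A \<tau> < t0"; cases "arr A \<tau> = t0")
        (auto simp: Q_def M_def New1_def New2_def pendc_def pending_def)
  qed
  moreover have "all_finished \<subseteq> ?U"
  proof
    fix \<tau> assume "\<tau> \<in> all_finished"
    note \<tau> = all_finishedD[OF this]
    show "\<tau> \<in> ?U"
      using \<tau> cost_cases[OF \<tau>(1)]
      by (cases "arr A \<tau> < t0"; cases "arr A \<tau> = t0")
        (auto simp: Q_def M_def New1_def New2_def pendc_def)
  qed
  moreover have "pend t \<inter> all_finished = {}" using all_finishedD(4) by auto
  ultimately have "card (pend t) + card all_finished \<le> card ?U"
    using card_mono[of ?U "pend t \<union> all_finished"] fin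
    by (metis card_Un_disjoint finite_UnI finite_subset le_sup_iff)
  also have "\<dots> \<le> card Q + card M + (card New1 + card New2)"
    by (meson add_mono card_Un_le order_trans)
  finally have 1: "card (pend t) + card all_finished \<le> card Q + card M + (card New1 + card New2)" .
  have "card New1 + card New2 + card MO = card (New1 \<union> New2 \<union> MO)"
  proof -
    have "New1 \<inter> New2 = {}" "(New1 \<union> New2) \<inter> MO = {}"
      using lmin_lmax by (auto simp: New1_def New2_def MO_def pending_def)
    then show ?thesis using fin by (simp add: card_Un_disjoint)
  qed
  also have "\<dots> \<le> card (opend S t \<union> T)"
    using fin finite_pending by (intro card_mono) (auto simp: T_def)
  also have "\<dots> \<le> card (opend S t) + card T" by (rule card_Un_le)
  also have "card T \<le> card all_finished + n * extra"
  proof (rule phase_compare[OF S])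
    fix \<tau> assume "\<tau> \<in> T"
    then show "True \<and> (\<exists>p \<sigma>. (p, \<sigma>, \<tau>) \<in> S \<and> t0 < \<sigma> + cost A \<tau> \<and> \<sigma> + cost A \<tau> \<le> t)"
      using t0(1)
      by (intro conjI offline_reported[OF S])
        (auto simp: T_def New1_def New2_def MO_def pending_def)
  qed
  finally have "card New1 + card New2 + card MO
      \<le> card (opend S t) + (card all_finished + n * extra)" by simp
  \<comment> \<open>This excess, incurred by \<open>t0\<close>, comes on top of the
    \<open>n^2\<close> from \<open>Q\<close> and of \<open>n * extra\<close>.\<close>
  moreover have "card M \<le> card MO + n^2 + 2 * n"
    unfolding M_def MO_def by (rule max_bound[OF S])
  ultimately show ?thesis using 1 t0(3) unfolding Q_def[symmetric] by simp
qed

lemma pending_cost_eq: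
  "pending_cost A Q t = lmin * real (card {\<tau> \<in> pending A Q t. cost A \<tau> = lmin})
     + lmax * real (card {\<tau> \<in> pending A Q t. cost A \<tau> = lmax})"
  "card (pending A Q t) = card {\<tau> \<in> pending A Q t. cost A \<tau> = lmin}
     + card {\<tau> \<in> pending A Q t. cost A \<tau> = lmax}"
proof -
  let ?N = "{\<tau> \<in> pending A Q t. cost A \<tau> = lmin}" and ?M = "{\<tau> \<in> pending A Q t. cost A \<tau> = lmax}"
  have U: "pending A Q t = ?N \<union> ?M" using cost_cases by (auto simp: pending_def)
  have D: "?N \<inter> ?M = {}" using lmin_lmax by auto
  have F: "finite ?N" "finite ?M" using finite_pending by simp_all
  show "card (pending A Q t) = card ?N + card ?M"
    by (subst U) (rule card_Un_disjoint[OF F D])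
  have "pending_cost A Q t = (\<Sum>\<tau>\<in>?N. cost A \<tau>) + (\<Sum>\<tau>\<in>?M. cost A \<tau>)"
    unfolding pending_cost_def by (subst U) (rule sum.union_disjoint[OF F D])
  then show "pending_cost A Q t = lmin * real (card ?N) + lmax * real (card ?M)" by simp
qed

lemma cost_bound:
  assumes S: "valid_offline n A S"
  shows "pending_cost A Rep t \<le> pending_cost A (offline_reports A S) t
     + lmax * (real n ^ 2 + 2 * real n)
     + lmin * (real n ^ 2 + (1 + real_of_int \<lceil>lmax / (s * lmin)\<rceil>) * real n)"
proof -
  define a1 a2 where "a1 = real (card (pendc lmin t))" and "a2 = real (card (pendc lmax t))"
  define o1 o2 where "o1 = real (card {\<tau> \<in> opend S t. cost A \<tau> = lmin})"
    and "o2 = real (card {\<tau> \<in> opend S t. cost A \<tau> = lmax})"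
  define K where "K = 1 + real_of_int \<lceil>lmax / (s * lmin)\<rceil>"
  have "0 < lmax / (s * lmin)" using lmax_pos lmin_pos s_gt1 by simp
  then have K: "K = real (1 + nat \<lceil>lmax / (s * lmin)\<rceil>)" by (simp add: K_def)
  have costs: "pending_cost A Rep t = lmin * a1 + lmax * a2"
    "pending_cost A (offline_reports A S) t = lmin * o1 + lmax * o2"
    by (simp_all only: pending_cost_eq(1) a1_def a2_def o1_def o2_def pendc_def)
  have max: "a2 \<le> o2 + (real n)^2 + 2 * real n"
    using max_bound[OF S, of t] unfolding a2_def o2_def
    by (metis (mono_tags, lifting) of_nat_add of_nat_le_iff of_nat_mult of_nat_numeral of_nat_power)
  show ?thesis
  proof (cases "n^2 \<le> card (pendc lmin t)")
    case False
    \<comment> \<open>A short lmin-queue costs at most \<open>lmin * n^2\<close>, which the claimed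
      bound contains.\<close>
    then have "a1 \<le> (real n)^2" unfolding a1_def by (simp flip: of_nat_power)
    moreover have "0 \<le> o1" "0 \<le> K * real n" unfolding o1_def K by simp_all
    ultimately have "lmin * a1 \<le> lmin * (o1 + ((real n)^2 + K * real n))"
      using lmin_pos by simp
    moreover have "lmax * a2 \<le> lmax * (o2 + (real n)^2 + 2 * real n)" using max lmax_pos by simp
    ultimately show ?thesis unfolding costs K_def[symmetric] by (simp add: algebra_simps)
  next
    case True
    have "real (card (pend t))
        \<le> real (card (opend S t) + 2 * n^2 + 2 * n + n * (1 + nat \<lceil>lmax / (s * lmin)\<rceil>))"
      using count_bound[OF S True] by (simp only: of_nat_le_iff)
    then have "a1 + a2 \<le> o1 + o2 + 2 * (real n)^2 + 2 * real n + real n * K"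
      unfolding K pending_cost_eq(2) a1_def a2_def o1_def o2_def pendc_def
      by (simp add: algebra_simps)
    then have "lmin * (a1 + a2) \<le> lmin * (o1 + o2 + 2 * (real n)^2 + 2 * real n + real n * K)"
      using lmin_pos by simp
    \<comment> \<open>The excess \<open>n^2 + 2 * n\<close> occurs in both estimates and so receives
      total weight \<open>lmax\<close>; what is left, \<open>n^2 + K * n\<close>, has weight
      \<open>lmin\<close>.\<close>
    moreover have "(lmax - lmin) * a2 \<le> (lmax - lmin) * (o2 + (real n)^2 + 2 * real n)"
      using max lmin_lmax by simp
    ultimately show ?thesis unfolding costs K_def[symmetric] by (simp add: algebra_simps)
  qed
qed

end

theorem theorem5:
  fixes n :: nat and s lmin lmax t :: real and A :: adv_pattern and X :: execution
  assumes "1 \<le> n"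
    and "0 < lmin" and "lmin < lmax"
    and "1 < s"
    and "(real (gamma s lmin lmax) * lmin + lmax) / lmax \<le> s" and "s < lmax / lmin"
    and "wf_pattern n lmin lmax A"
    and "burst_exec n s lmin lmax A X"
  shows "pending_cost A (reports n s A X) t
           \<le> opt_pending_cost n A t + lmax * (real n ^ 2 + 2 * real n)
              + lmin * (real n ^ 2 + (1 + real_of_int \<lceil>lmax / (s * lmin)\<rceil>) * real n)"
proof -
  interpret burst n s lmin lmax A X by unfold_locales (fact assms)+
  let ?K = "lmax * (real n ^ 2 + 2 * real n)
    + lmin * (real n ^ 2 + (1 + real_of_int \<lceil>lmax / (s * lmin)\<rceil>) * real n)"
  \<comment> \<open>The empty schedule makes the infimum range over a nonempty set, so a bound valid
    for every schedule passes to it.\<close>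
  have "valid_offline n A {}" by (simp add: valid_offline_def)
  then have "{S. valid_offline n A S} \<noteq> {}" by blast
  then have "pending_cost A (reports n s A X) t - ?K \<le> opt_pending_cost n A t"
    unfolding opt_pending_cost_def
    by (rule cINF_greatest) (use cost_bound in \<open>force simp: algebra_simps\<close>)
  then show ?thesis by simp
qed

end
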